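(* Assume $F$ satisfies (F1), (F2), (F3) and let $G$ be the associated operator. An upper semicontinuous function $u:\mathbb R^n\times(0,+\infty)\to\mathbb R$ is a viscosity subsolution of $u_t+F(x,t,Xu,X^2u)=0$ if and only if for every $\phi\in C^2(\mathbb R^n\times(0,+\infty))$ and every local maximum point $(x,t)\in\mathbb R^n\times(0,+\infty)$ of $u-\phi$ one has $$\partial_t\phi(x,t)+F(x,t,X\phi(x,t),X^2\phi(x,t))\le 0\quad\text{if } X\phi(x,t)\neq 0,$$ and $$\partial_t\phi(x,t)\le 0\quad\text{if } X\phi(x,t)=0 \text{ and } X^2\phi(x,t)=\mathbb O.$$ Analogously, a lower semicontinuous $u$ is a viscosity supersolution if and only if for every $\phi\in C^2$ and every local minimum point $(x,t)$ of $u-\phi$ one has $\partial_t\phi(x,t)+F(x,t,X\phi(x,t),X^2\phi(x,t))\ge0$ if $X\phi(x,t)\ne0$, and $\partial_t\phi(x,t)\ge0$ if $X\phi(x,t)=0$ and $X^2\phi(x,t)=\mathbb O$.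
   Context: Step two Carnot group setting. Write $\mathbb R^n=\mathbb R^m\times\mathbb R^{n-m}$ with $2\le m<n$ and points $x=(x_h,x_v)$. Fix $n-m$ linearly independent skew-symmetric $m\times m$ real matrices $B^{(1)},\dots,B^{(n-m)}$. Let $\sigma(x)$ be the $n\times m$ matrix whose first $m$ rows form $I_m$ and whose $(m+k)$-th row is ${}^t(B^{(k)}x_h)$. The vector fields are $X_j=\sum_{i}\sigma_{ij}(x)\partial_i$, $j=1,\dots,m$; the group law is $x\circ y=(x_h+y_h,x_v+y_v+(B^{(k)}x_h\cdot y_h)_{k})$. For $u\in C^2$, $Xu=\nabla u\,\sigma(x)$ (row vector) and $X^2u={}^t\sigma(x)D^2u\,\sigma(x)$. $\mathcal S^m$ is the set of real symmetric $m\times m$ matrices. Standing assumptions on $F$: $F:\mathbb R^n\times(0,+\infty)\times(\mathbb R^m\setminus\{0\})\times\mathcal S^m\to\mathbb R$ is continuous and locally bounded near points of the form $(x,t,0,A)$; its lower/upper semicontinuous envelopes at $q=0$ are $F_*(x,t,0,A)=\lim_{r\to0^+}\inf\{F(y,t,q,B):q\ne0,\ |(y,q,B)-(x,0,A)|\le r\}$ and $F^*$ analogously with $\sup$ (for $q\ne0$, $F_*=F^*=F$). (F1) $F^*(x,t,0,\mathbb O)=F_*(x,t,0,\mathbb O)$ for all $(x,t)$. (F2) Ellipticity: $F(x,t,p,A)\le F(x,t,p,B)$ whenever $A\ge B$. (F3) Geometric: $F(x,t,\lambda p,\lambda A+\mu\,p\otimes p)=\lambda F(x,t,p,A)$ for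 all $\lambda>0$, $\mu\in\mathbb R$, $p\ne0$, $A\in\mathcal S^m$. Associated operator: $G(x,t,p,A)=F(x,t,p\sigma(x),{}^t\sigma(x)A\sigma(x))$ for $p\in\mathbb R^n$ (row) with $p\sigma(x)\ne0$, $A\in\mathcal S^n$; $G_*$ and $G^*$ denote its lower and upper semicontinuous envelopes on all of $\mathbb R^n\times(0,\infty)\times\mathbb R^n\times\mathcal S^n$, e.g. $G_*(x,t,p,A)=\lim_{r\to0^+}\inf\{G(y,s,q,B): q\sigma(y)\ne0,\ |(x-y,t-s,p-q,A-B)|\le r\}$. Viscosity solutions of $u_t+F(x,t,Xu,X^2u)=0$ on $\mathbb R^n\times(0,\infty)$: an upper semicontinuous $u$ is a subsolution if for every $\phi\in C^2$ and every local maximum point $(x,t)$ of $u-\phi$, $\phi_t(x,t)+G_*(x,t,\nabla\phi(x,t),D^2\phi(x,t))\le0$; a lower semicontinuous $u$ is a supersolution if for every $\phi\in C^2$ and every local minimum point $(x,t)$ of $u-\phi$, $\phi_t(x,t)+G^*(x,t,\nabla\phi(x,t),D^2\phi(x,t))\ge0$; a solution is a continuous function that is both. *)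

theory Defs
  imports "HOL-Analysis.Analysis"
begin

text \<open>Points of R^n are vectors indexed by the finite type 'm + 'k:
  index Inl i is the i-th horizontal coordinate (i in 'm, m = CARD('m)),
  index Inr k is the k-th vertical coordinate (k in 'k, n - m = CARD('k)).
  Time is a separate real coordinate; the domain is R^n x (0, infinity).\<close>

definition symm :: "real^'a^'a \<Rightarrow> bool" where
  "symm A \<longleftrightarrow> transpose A = A"

definition psd :: "real^'a^'a \<Rightarrow> bool" where
  "psd A \<longleftrightarrow> (\<forall>v. 0 \<le> v \<bullet> (A *v v))"

definition outer :: "real^'a \<Rightarrow> real^'a^'a" where
  "outer p = (\<chi> i j. p $ i * p $ j)"

definition step2_data :: "('k::finite \<Rightarrow> real^'m^'m) \<Rightarrow> bool" where
  "step2_data B \<longleftrightarrow> (\<forall>k. transpose (B k) = - B k)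
     \<and> (\<forall>c::'k \<Rightarrow> real. (\<Sum>k\<in>UNIV. c k *\<^sub>R B k) = 0 \<longrightarrow> (\<forall>k. c k = 0))"

definition hpart :: "real^('m::finite + 'k::finite) \<Rightarrow> real^'m" where
  "hpart x = (\<chi> i. x $ Inl i)"

definition sigma :: "('k::finite \<Rightarrow> real^'m::finite^'m) \<Rightarrow> real^('m + 'k) \<Rightarrow> real^'m^('m + 'k)" where
  "sigma B x = (\<chi> r j. case r of Inl i \<Rightarrow> (if i = j then 1 else 0)
                              | Inr k \<Rightarrow> (B k *v hpart x) $ j)"

definition Omega :: "((real^'n) \<times> real) set" where
  "Omega = UNIV \<times> {0<..}"

definition usc_on :: "('a::topological_space) set \<Rightarrow> ('a \<Rightarrow> real) \<Rightarrow> bool" where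
  "usc_on S u \<longleftrightarrow> (\<forall>z\<in>S. \<forall>c. u z < c \<longrightarrow> (\<forall>\<^sub>F w in at z within S. u w < c))"

definition lsc_on :: "('a::topological_space) set \<Rightarrow> ('a \<Rightarrow> real) \<Rightarrow> bool" where
  "lsc_on S u \<longleftrightarrow> (\<forall>z\<in>S. \<forall>c. c < u z \<longrightarrow> (\<forall>\<^sub>F w in at z within S. c < u w))"

definition C2_on :: "((real^'n) \<times> real) set \<Rightarrow> ((real^'n) \<times> real \<Rightarrow> real) \<Rightarrow> bool" where
  "C2_on S \<phi> \<longleftrightarrow> (\<exists>(D :: (real^'n) \<times> real \<Rightarrow> ((real^'n) \<times> real) \<Rightarrow>\<^sub>L real)
      (D2 :: (real^'n) \<times> real \<Rightarrow> ((real^'n) \<times> real) \<Rightarrow>\<^sub>L (((real^'n) \<times> real) \<Rightarrow>\<^sub>L real)).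
      (\<forall>z\<in>S. (\<phi> has_derivative blinfun_apply (D z)) (at z))
    \<and> (\<forall>z\<in>S. (D has_derivative blinfun_apply (D2 z)) (at z))
    \<and> continuous_on S D2)"

definition dtime :: "((real^'n) \<times> real \<Rightarrow> real) \<Rightarrow> (real^'n) \<times> real \<Rightarrow> real" where
  "dtime \<phi> z = frechet_derivative \<phi> (at z) (0, 1)"

definition grad :: "((real^'n) \<times> real \<Rightarrow> real) \<Rightarrow> (real^'n) \<times> real \<Rightarrow> real^'n" where
  "grad \<phi> z = (\<chi> i. frechet_derivative \<phi> (at z) (axis i 1, 0))"

definition hess :: "((real^'n) \<times> real \<Rightarrow> real) \<Rightarrow> (real^'n) \<times> real \<Rightarrow> real^'n^'n" where
  "hess \<phi> z = (\<chi> i j. frechet_derivative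
       (\<lambda>w. frechet_derivative \<phi> (at w) (axis j 1, 0)) (at z) (axis i 1, 0))"

definition local_max_at :: "('a::metric_space) set \<Rightarrow> ('a \<Rightarrow> real) \<Rightarrow> 'a \<Rightarrow> bool" where
  "local_max_at S f z \<longleftrightarrow> (\<exists>r>0. \<forall>w\<in>S. dist w z < r \<longrightarrow> f w \<le> f z)"

definition local_min_at :: "('a::metric_space) set \<Rightarrow> ('a \<Rightarrow> real) \<Rightarrow> 'a \<Rightarrow> bool" where
  "local_min_at S f z \<longleftrightarrow> (\<exists>r>0. \<forall>w\<in>S. dist w z < r \<longrightarrow> f z \<le> f w)"

type_synonym ('m, 'k) Fop = "real^('m + 'k) \<Rightarrow> real \<Rightarrow> real^'m \<Rightarrow> real^'m^'m \<Rightarrow> real"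

definition F_lower :: "('m::finite, 'k::finite) Fop \<Rightarrow> real^('m+'k) \<Rightarrow> real \<Rightarrow> real^'m^'m \<Rightarrow> real" where
  "F_lower F x t A = Lim (at_right 0) (\<lambda>r. Inf {F y t q C | y q C.
      q \<noteq> 0 \<and> symm C \<and> norm ((y, q, C) - (x, 0, A)) \<le> r})"

definition F_upper :: "('m::finite, 'k::finite) Fop \<Rightarrow> real^('m+'k) \<Rightarrow> real \<Rightarrow> real^'m^'m \<Rightarrow> real" where
  "F_upper F x t A = Lim (at_right 0) (\<lambda>r. Sup {F y t q C | y q C.
      q \<noteq> 0 \<and> symm C \<and> norm ((y, q, C) - (x, 0, A)) \<le> r})"

definition F_standing :: "('m::finite, 'k::finite) Fop \<Rightarrow> bool" where
  "F_standing F \<longleftrightarrow>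
     continuous_on {(x, t, q, A). 0 < t \<and> q \<noteq> 0 \<and> symm A} (\<lambda>(x, t, q, A). F x t q A)
   \<and> (\<forall>x t A. 0 < t \<longrightarrow> symm A \<longrightarrow> (\<exists>r>0. \<exists>M. \<forall>y s q C.
        0 < s \<and> q \<noteq> 0 \<and> symm C \<and> norm ((y, s, q, C) - (x, t, 0, A)) < r
        \<longrightarrow> \<bar>F y s q C\<bar> \<le> M))"

definition F1 :: "('m::finite, 'k::finite) Fop \<Rightarrow> bool" where
  "F1 F \<longleftrightarrow> (\<forall>x t. 0 < t \<longrightarrow> F_upper F x t 0 = F_lower F x t 0)"

definition F2 :: "('m::finite, 'k::finite) Fop \<Rightarrow> bool" where
  "F2 F \<longleftrightarrow> (\<forall>x t p A C. 0 < t \<and> p \<noteq> 0 \<and> symm A \<and> symm C \<and> psd (A - C)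
      \<longrightarrow> F x t p A \<le> F x t p C)"

definition F3 :: "('m::finite, 'k::finite) Fop \<Rightarrow> bool" where
  "F3 F \<longleftrightarrow> (\<forall>x t p A (lam::real) mu. 0 < t \<and> p \<noteq> 0 \<and> symm A \<and> 0 < lam
      \<longrightarrow> F x t (lam *\<^sub>R p) (lam *\<^sub>R A + mu *\<^sub>R outer p) = lam * F x t p A)"

definition Gop :: "('m::finite, 'k::finite) Fop \<Rightarrow> ('k \<Rightarrow> real^'m^'m) \<Rightarrow>
    real^('m+'k) \<Rightarrow> real \<Rightarrow> real^('m+'k) \<Rightarrow> real^('m+'k)^('m+'k) \<Rightarrow> real" where
  "Gop F B x t p A = F x t (p v* sigma B x) (transpose (sigma B x) ** A ** sigma B x)"

definition G_lower :: "('m::finite, 'k::finite) Fop \<Rightarrow> ('k \<Rightarrow> real^'m^'m) \<Rightarrow>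
    real^('m+'k) \<Rightarrow> real \<Rightarrow> real^('m+'k) \<Rightarrow> real^('m+'k)^('m+'k) \<Rightarrow> real" where
  "G_lower F B x t p A = Lim (at_right 0) (\<lambda>r. Inf {Gop F B y s q C | y s q C.
      q v* sigma B y \<noteq> 0 \<and> 0 < s \<and> symm C \<and> norm (x - y, t - s, p - q, A - C) \<le> r})"

definition G_upper :: "('m::finite, 'k::finite) Fop \<Rightarrow> ('k \<Rightarrow> real^'m^'m) \<Rightarrow>
    real^('m+'k) \<Rightarrow> real \<Rightarrow> real^('m+'k) \<Rightarrow> real^('m+'k)^('m+'k) \<Rightarrow> real" where
  "G_upper F B x t p A = Lim (at_right 0) (\<lambda>r. Sup {Gop F B y s q C | y s q C.
      q v* sigma B y \<noteq> 0 \<and> 0 < s \<and> symm C \<and> norm (x - y, t - s, p - q, A - C) \<le> r})"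

definition visc_sub :: "('m::finite, 'k::finite) Fop \<Rightarrow> ('k \<Rightarrow> real^'m^'m) \<Rightarrow>
    ((real^('m+'k)) \<times> real \<Rightarrow> real) \<Rightarrow> bool" where
  "visc_sub F B u \<longleftrightarrow> usc_on Omega u \<and>
     (\<forall>\<phi>. C2_on Omega \<phi> \<longrightarrow> (\<forall>x t. 0 < t \<and> local_max_at Omega (\<lambda>z. u z - \<phi> z) (x, t) \<longrightarrow>
        dtime \<phi> (x, t) + G_lower F B x t (grad \<phi> (x, t)) (hess \<phi> (x, t)) \<le> 0))"

definition visc_super :: "('m::finite, 'k::finite) Fop \<Rightarrow> ('k \<Rightarrow> real^'m^'m) \<Rightarrow>
    ((real^('m+'k)) \<times> real \<Rightarrow> real) \<Rightarrow> bool" where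
  "visc_super F B u \<longleftrightarrow> lsc_on Omega u \<and>
     (\<forall>\<phi>. C2_on Omega \<phi> \<longrightarrow> (\<forall>x t. 0 < t \<and> local_min_at Omega (\<lambda>z. u z - \<phi> z) (x, t) \<longrightarrow>
        dtime \<phi> (x, t) + G_upper F B x t (grad \<phi> (x, t)) (hess \<phi> (x, t)) \<ge> 0))"

definition Xgrad :: "('k::finite \<Rightarrow> real^'m::finite^'m) \<Rightarrow> ((real^('m+'k)) \<times> real \<Rightarrow> real) \<Rightarrow>
    (real^('m+'k)) \<times> real \<Rightarrow> real^'m" where
  "Xgrad B \<phi> z = grad \<phi> z v* sigma B (fst z)"

definition Xhess :: "('k::finite \<Rightarrow> real^'m::finite^'m) \<Rightarrow> ((real^('m+'k)) \<times> real \<Rightarrow> real) \<Rightarrow>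
    (real^('m+'k)) \<times> real \<Rightarrow> real^'m^'m" where
  "Xhess B \<phi> z = transpose (sigma B (fst z)) ** hess \<phi> z ** sigma B (fst z)"

end

theory Submission
  imports Defs
begin

text \<open>
  Homogeneity (F3) and local boundedness force \<open>F (y, s, q, C) \<rightarrow> 0\<close> as \<open>(q, C) \<rightarrow> 0\<close>, so the envelopes of \<open>G\<close>
  vanish where \<open>X\<phi> = 0\<close> and \<open>X\<^sup>2\<phi> = 0\<close>; where \<open>X\<phi> \<noteq> 0\<close> they agree with \<open>F\<close> by continuity. This gives
  one direction.

  For the converse, make the maximum of \<open>u - \<phi>\<close> at \<open>(x0, t0)\<close> strict and maximise
  \<open>u (x, t) - \<phi> (y, t) - N \<psi> (y\<inverse> \<circ> x)\<close> with \<open>\<psi> (\<eta>) = \<bar>\<eta>\<^sub>h\<bar>\<^sup>4 + \<bar>\<eta>\<^sub>v\<bar>\<^sup>2\<close>. The horizontal gradient of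
  this gauge vanishes only where \<open>\<eta>\<^sub>h = 0\<close>, and there its horizontal Hessian vanishes too. With
  \<open>\<eta> = y\<inverse> \<circ> x\<close> at the maximum there are two cases. If \<open>\<eta>\<^sub>h \<noteq> 0\<close>, the right translate
  \<open>\<phi> (x \<circ> \<eta>\<inverse>, t)\<close> is a test function for \<open>u\<close> with nonzero horizontal gradient, and its derivatives are
  close to those of \<open>\<phi>\<close> at \<open>(x0, t0)\<close>. If \<open>\<eta>\<^sub>h = 0\<close>, the test function
  \<open>N \<psi> (y\<inverse> \<circ> x) + \<phi> (y, t)\<close>, with \<open>y\<close> frozen, has \<open>X = 0\<close> and \<open>X\<^sup>2 = 0\<close>, whence \<open>\<partial>\<^sub>t\<phi> (y, t) \<le> 0\<close>;
  optimality in \<open>y\<close> gives \<open>X\<phi> (y, t) = 0\<close> and \<open>X\<^sup>2\<phi> (y, t) \<ge> 0\<close>, and ellipticity together with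
  homogeneity bounds \<open>G\<close> near this point. Supersolutions reduce to subsolutions through
  \<open>u \<mapsto> - u\<close> and \<open>F (x, t, p, A) \<mapsto> - F (x, t, - p, - A)\<close>.
\<close>

section \<open>Second order jets\<close>

text \<open>Scalar components of the first and second derivatives replace the \<open>blinfun\<close>-valued maps of
  \<open>C2_on\<close>, so that the usual rules for real derivatives apply.\<close>

definition has_jet :: "'a::euclidean_space set \<Rightarrow> ('a \<Rightarrow> real) \<Rightarrow> ('a \<Rightarrow> 'a \<Rightarrow> real) \<Rightarrow>
    ('a \<Rightarrow> 'a \<Rightarrow> 'a \<Rightarrow> real) \<Rightarrow> bool" where
  "has_jet S f d d2 \<longleftrightarrow>
     (\<forall>z\<in>S. (f has_derivative d z) (at z))
   \<and> (\<forall>k. \<forall>z\<in>S. ((\<lambda>w. d w k) has_derivative (\<lambda>h. d2 z h k)) (at z))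
   \<and> (\<forall>h k. continuous_on S (\<lambda>z. d2 z h k))"

lemma has_jetD:
  assumes "has_jet S f d d2"
  shows "z \<in> S \<Longrightarrow> (f has_derivative d z) (at z)"
    and "z \<in> S \<Longrightarrow> ((\<lambda>w. d w k) has_derivative (\<lambda>h. d2 z h k)) (at z)"
    and "continuous_on S (\<lambda>z. d2 z h k)"
  using assms by (auto simp: has_jet_def)

lemma has_jet_linear:
  assumes "has_jet S f d d2" "z \<in> S"
  shows "linear (d z)" and "linear (\<lambda>h. d2 z h k)"
  by (rule has_derivative_linear[OF has_jetD(1)[OF assms]])
    (rule has_derivative_linear[OF has_jetD(2)[OF assms]])

lemma has_jet_continuous_on:
  assumes "has_jet S f d d2"
  shows "continuous_on S f" and "continuous_on S (\<lambda>z. d z k)"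
  by (auto intro: continuous_at_imp_continuous_on has_derivative_continuous[OF has_jetD(1)[OF assms]]
      has_derivative_continuous[OF has_jetD(2)[OF assms]])

text \<open>In finite dimension a bounded linear map is determined by its values on
  \<open>Basis\<close>, so differentiability and continuity of \<open>blinfun\<close>-valued maps
  reduce to finitely many scalar components.\<close>

lemma C2_on_iff_jet: "C2_on S \<phi> \<longleftrightarrow> (\<exists>d d2. has_jet S \<phi> d d2)"
proof
  assume "C2_on S \<phi>"
  then obtain D D2 where 1: "\<forall>z\<in>S. (\<phi> has_derivative blinfun_apply (D z)) (at z)"
    and 2: "\<forall>z\<in>S. (D has_derivative blinfun_apply (D2 z)) (at z)" and 3: "continuous_on S D2"
    unfolding C2_on_def by blast
  have "has_jet S \<phi> (\<lambda>z. blinfun_apply (D z)) (\<lambda>z h. blinfun_apply (blinfun_apply (D2 z) h))"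
    unfolding has_jet_def
  proof (intro conjI allI ballI)
    fix z k assume "z \<in> S"
    with 2 show "((\<lambda>w. blinfun_apply (D w) k) has_derivative
        (\<lambda>h. blinfun_apply (blinfun_apply (D2 z) h) k)) (at z)"
      using bounded_linear.has_derivative[OF blinfun.bounded_linear_left] by blast
  next
    fix h k
    show "continuous_on S (\<lambda>z. blinfun_apply (blinfun_apply (D2 z) h) k)"
      by (intro continuous_intros 3)
  qed (use 1 in auto)
  then show "\<exists>d d2. has_jet S \<phi> d d2" by blast
next
  assume "\<exists>d d2. has_jet S \<phi> d d2"
  then obtain d d2 where j: "has_jet S \<phi> d d2" by blast
  define D :: "(real^'a) \<times> real \<Rightarrow> ((real^'a) \<times> real) \<Rightarrow>\<^sub>L real"
    where "D z = (\<Sum>b\<in>Basis. d z b *\<^sub>R blinfun_inner_left b)" for z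
  define D2 :: "(real^'a) \<times> real \<Rightarrow> ((real^'a) \<times> real) \<Rightarrow>\<^sub>L (((real^'a) \<times> real) \<Rightarrow>\<^sub>L real)"
    where "D2 z = Blinfun (\<lambda>h. \<Sum>b\<in>Basis. d2 z h b *\<^sub>R blinfun_inner_left b)" for z
  have der: "(D has_derivative (\<lambda>h. \<Sum>b\<in>Basis. d2 z h b *\<^sub>R blinfun_inner_left b)) (at z)"
    if "z \<in> S" for z
    unfolding D_def
    by (intro has_derivative_sum has_derivative_scaleR_left has_jetD(2)[OF j that])
  have D2: "blinfun_apply (D2 z) = (\<lambda>h. \<Sum>b\<in>Basis. d2 z h b *\<^sub>R blinfun_inner_left b)"
    if "z \<in> S" for z
    unfolding D2_def using has_derivative_bounded_linear[OF der[OF that]]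
    by (simp add: bounded_linear_Blinfun_apply)
  have D: "blinfun_apply (D z) = d z" if "z \<in> S" for z
  proof
    fix h
    interpret linear "d z" using has_jet_linear[OF j that] by blast
    have "blinfun_apply (D z) h = (\<Sum>b\<in>Basis. d z b * (h \<bullet> b))"
      unfolding D_def by (simp add: blinfun.sum_left blinfun.scaleR_left)
    also have "\<dots> = d z (\<Sum>b\<in>Basis. (h \<bullet> b) *\<^sub>R b)"
      by (simp add: sum scaleR mult.commute)
    finally show "blinfun_apply (D z) h = d z h" by (simp add: euclidean_representation)
  qed
  have "continuous_on S D2"
  proof (rule continuous_on_blinfun_componentwise)
    fix i :: "(real^'a) \<times> real"
    have "continuous_on S (\<lambda>z. \<Sum>b\<in>Basis. d2 z i b *\<^sub>R blinfun_inner_left b)"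
      by (intro continuous_intros has_jetD(3)[OF j])
    then show "continuous_on S (\<lambda>x. blinfun_apply (D2 x) i)"
      by (rule continuous_on_eq) (simp add: D2)
  qed
  then show "C2_on S \<phi>"
    unfolding C2_on_def using D D2 der has_jetD(1)[OF j] by (intro exI[of _ D] exI[of _ D2]) simp
qed

text \<open>\<open>hess\<close> differentiates the map sending \<open>w\<close> to
  \<open>frechet_derivative \<phi> (at w)\<close>, which is known to agree with \<open>d w\<close>
  on \<open>S\<close>; openness of \<open>S\<close> lets the derivative be transferred.\<close>

lemma jet_derivs:
  fixes \<phi> :: "(real^'n) \<times> real \<Rightarrow> real"
  assumes j: "has_jet S \<phi> d d2" and S: "open S" "z \<in> S"
  shows "dtime \<phi> z = d z (0, 1)"
    and "grad \<phi> z = (\<chi> i. d z (axis i 1, 0))"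
    and "hess \<phi> z = (\<chi> i j. d2 z (axis i 1, 0) (axis j 1, 0))"
proof -
  have fr: "frechet_derivative \<phi> (at w) = d w" if "w \<in> S" for w
    using frechet_derivative_at[OF has_jetD(1)[OF j that]] by simp
  show "dtime \<phi> z = d z (0, 1)" "grad \<phi> z = (\<chi> i. d z (axis i 1, 0))"
    using fr S by (simp_all add: dtime_def grad_def)
  have "frechet_derivative (\<lambda>w. frechet_derivative \<phi> (at w) k) (at z) = (\<lambda>h. d2 z h k)" for k
  proof -
    have "((\<lambda>w. frechet_derivative \<phi> (at w) k) has_derivative (\<lambda>h. d2 z h k)) (at z)"
      by (rule has_derivative_transform_within_open[OF has_jetD(2)[OF j S(2)] S]) (simp add: fr)
    from frechet_derivative_at[OF this] show ?thesis by simp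
  qed
  then show "hess \<phi> z = (\<chi> i j. d2 z (axis i 1, 0) (axis j 1, 0))"
    by (simp add: hess_def)
qed

lemma jet_line_derivs:
  assumes j: "has_jet S f d d2" and z: "z + s *\<^sub>R h \<in> S"
  shows "((\<lambda>s. f (z + s *\<^sub>R h)) has_real_derivative d (z + s *\<^sub>R h) h) (at s)"
    and "((\<lambda>s. d (z + s *\<^sub>R h) k) has_real_derivative d2 (z + s *\<^sub>R h) h k) (at s)"
proof -
  have l: "((\<lambda>s. z + s *\<^sub>R h) has_derivative (\<lambda>r. r *\<^sub>R h)) (at s)"
    by (auto intro!: derivative_eq_intros)
  have "((\<lambda>s. f (z + s *\<^sub>R h)) has_derivative (\<lambda>r. d (z + s *\<^sub>R h) (r *\<^sub>R h))) (at s)"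
    using has_derivative_compose[OF l has_jetD(1)[OF j z]] by simp
  moreover have "((\<lambda>s. d (z + s *\<^sub>R h) k) has_derivative (\<lambda>r. d2 (z + s *\<^sub>R h) (r *\<^sub>R h) k)) (at s)"
    using has_derivative_compose[OF l has_jetD(2)[OF j z]] by simp
  ultimately
  show "((\<lambda>s. f (z + s *\<^sub>R h)) has_real_derivative d (z + s *\<^sub>R h) h) (at s)"
    and "((\<lambda>s. d (z + s *\<^sub>R h) k) has_real_derivative d2 (z + s *\<^sub>R h) h k) (at s)"
    using linear_scale[OF has_jet_linear(1)[OF j z]] linear_scale[OF has_jet_linear(2)[OF j z]]
    by (simp_all add: has_field_derivative_def mult_commute_abs)
qed

text \<open>The second difference is symmetric in \<open>h\<close> and \<open>k\<close>, which yields Schwarz's theorem on letting \<open>s \<rightarrow> 0\<close>.\<close>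

lemma jet_second_difference:
  assumes j: "has_jet S f d d2" and s: "0 < s" and B: "ball z r \<subseteq> S"
    and small: "s * (norm h + norm k) < r"
  obtains \<zeta> where "dist z \<zeta> \<le> s * (norm h + norm k)"
    "f (z + s *\<^sub>R h + s *\<^sub>R k) - f (z + s *\<^sub>R h) - f (z + s *\<^sub>R k) + f z = s * s * d2 \<zeta> k h"
proof -
  have nrm: "norm (a *\<^sub>R h + b *\<^sub>R k) \<le> s * (norm h + norm k)"
    if "0 \<le> a" "a \<le> s" "0 \<le> b" "b \<le> s" for a b
  proof -
    have "norm (a *\<^sub>R h + b *\<^sub>R k) \<le> a * norm h + b * norm k"
      using norm_triangle_ineq[of "a *\<^sub>R h" "b *\<^sub>R k"] that by simp
    also have "\<dots> \<le> s * norm h + s * norm k"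
      using that by (intro add_mono mult_right_mono) auto
    finally show ?thesis by (simp add: algebra_simps)
  qed
  have dst: "dist z (z + a *\<^sub>R h + b *\<^sub>R k) \<le> s * (norm h + norm k)"
    if "0 \<le> a" "a \<le> s" "0 \<le> b" "b \<le> s" for a b
    using nrm[OF that] by (metis add.assoc add_diff_cancel_left' dist_commute dist_norm)
  have inS: "z + a *\<^sub>R h + b *\<^sub>R k \<in> S" if "0 \<le> a" "a \<le> s" "0 \<le> b" "b \<le> s" for a b
    using dst[OF that] small B by (auto simp: subset_eq)
  \<comment> \<open>The mean value theorem is applied twice: to \<open>g\<close>, moving along
    \<open>h\<close>, and then to the derivative in direction \<open>h\<close>, moving along
    \<open>k\<close>. The direction of the second differentiation is the first argument of
    \<open>d2\<close>.\<close>
  define g where "g a = f (z + a *\<^sub>R h + s *\<^sub>R k) - f (z + a *\<^sub>R h)" for a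
  have "\<exists>a. 0 < a \<and> a < s \<and> g s - g 0 = (s - 0) * (d (z + a *\<^sub>R h + s *\<^sub>R k) h - d (z + a *\<^sub>R h) h)"
  proof (rule MVT2[OF s])
    fix a assume a: "0 \<le> a" "a \<le> s"
    have 1: "((\<lambda>a. f (z + s *\<^sub>R k + a *\<^sub>R h)) has_real_derivative d (z + s *\<^sub>R k + a *\<^sub>R h) h) (at a)"
      using inS[of a s] a s by (intro jet_line_derivs(1)[OF j]) (simp add: algebra_simps)
    have 2: "((\<lambda>a. f (z + a *\<^sub>R h)) has_real_derivative d (z + a *\<^sub>R h) h) (at a)"
      using inS[of a 0] a s by (intro jet_line_derivs(1)[OF j]) (simp add: algebra_simps)
    have eq: "z + s *\<^sub>R k + a *\<^sub>R h = z + a *\<^sub>R h + s *\<^sub>R k" for a by (simp add: algebra_simps)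
    show "(g has_real_derivative d (z + a *\<^sub>R h + s *\<^sub>R k) h - d (z + a *\<^sub>R h) h) (at a)"
      unfolding g_def using DERIV_diff[OF 1 2] by (simp only: eq)
  qed
  then obtain a where a: "0 < a" "a < s"
    and ga: "g s - g 0 = s * (d (z + a *\<^sub>R h + s *\<^sub>R k) h - d (z + a *\<^sub>R h) h)" by auto
  have "\<exists>b. 0 < b \<and> b < s \<and> d (z + a *\<^sub>R h + s *\<^sub>R k) h - d (z + a *\<^sub>R h + 0 *\<^sub>R k) h
      = (s - 0) * d2 (z + a *\<^sub>R h + b *\<^sub>R k) k h"
    using a inS by (intro MVT2[OF s] jet_line_derivs(2)[OF j]) auto
  then obtain b where b: "0 < b" "b < s" and gb: "d (z + a *\<^sub>R h + s *\<^sub>R k) h - d (z + a *\<^sub>R h) h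
      = s * d2 (z + a *\<^sub>R h + b *\<^sub>R k) k h" by auto
  show ?thesis
    by (rule that[of "z + a *\<^sub>R h + b *\<^sub>R k"]) (use dst[of a b] a b ga gb in \<open>auto simp: g_def\<close>)
qed

lemma jet_symmetric:
  assumes j: "has_jet S f d d2" and S: "open S" "z \<in> S"
  shows "d2 z h k = d2 z k h"
proof (rule ccontr)
  assume ne: "d2 z h k \<noteq> d2 z k h"
  define e where "e = \<bar>d2 z h k - d2 z k h\<bar> / 2"
  have e: "e > 0" using ne by (simp add: e_def)
  obtain r0 where r0: "r0 > 0" "ball z r0 \<subseteq> S" using S open_contains_ball by blast
  have "isCont (\<lambda>w. d2 w a b) z" for a b
    using has_jetD(3)[OF j] S continuous_on_eq_continuous_at by blast
  then have "\<exists>r>0. \<forall>w. dist w z < r \<longrightarrow> dist (d2 w a b) (d2 z a b) < e" for a b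
    using e unfolding continuous_at_eps_delta by blast
  then obtain r1 r2 where r1: "r1 > 0" "\<And>w. dist w z < r1 \<Longrightarrow> dist (d2 w h k) (d2 z h k) < e"
    and r2: "r2 > 0" "\<And>w. dist w z < r2 \<Longrightarrow> dist (d2 w k h) (d2 z k h) < e" by meson
  define r where "r = min r0 (min r1 r2)"
  have r: "r > 0" "ball z r \<subseteq> S" using r0 r1 r2 by (auto simp: r_def)
  \<comment> \<open>This scale keeps the whole parallelogram, hence both intermediate points, in the
    ball where each mixed derivative is within \<open>e\<close> of its value at
    \<open>z\<close>.\<close>
  define s where "s = r / (norm h + norm k + 1)"
  have pos: "norm h + norm k + 1 > 0" by (simp add: add_nonneg_pos)
  have s: "s > 0" using r pos by (simp add: s_def)
  have "s * (norm h + norm k + 1) = r" using pos by (simp add: s_def)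
  then have small: "s * (norm h + norm k) < r" using s by (simp add: algebra_simps)
  obtain u where u: "dist z u \<le> s * (norm h + norm k)"
    "f (z + s *\<^sub>R h + s *\<^sub>R k) - f (z + s *\<^sub>R h) - f (z + s *\<^sub>R k) + f z = s * s * d2 u k h"
    using jet_second_difference[OF j s r(2) small] by blast
  obtain v where v: "dist z v \<le> s * (norm k + norm h)"
    "f (z + s *\<^sub>R k + s *\<^sub>R h) - f (z + s *\<^sub>R k) - f (z + s *\<^sub>R h) + f z = s * s * d2 v h k"
    using jet_second_difference[OF j s r(2), of k h] small by (metis add.commute)
  have "s * s * d2 u k h = s * s * d2 v h k"
    using u(2) v(2) by (simp add: algebra_simps)
  then have "d2 u k h = d2 v h k" using s by simp
  moreover have "dist (d2 v h k) (d2 z h k) < e"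
    using v small by (intro r1) (simp add: dist_commute r_def add.commute)
  moreover have "dist (d2 u k h) (d2 z k h) < e"
    using u small by (intro r2) (simp add: dist_commute r_def)
  ultimately have "dist (d2 z h k) (d2 z k h) < e + e"
    by (metis dist_commute dist_triangle_less_add)
  then show False by (simp add: e_def dist_real_def)
qed

text \<open>Only the restriction to one line enters, which allows the spatial variable to be varied
  with time held fixed.\<close>

lemma jet_min_along_line:
  assumes j: "has_jet S f d d2" and S: "open S" "z \<in> S"
    and r: "r > 0" and mn: "\<And>s. \<bar>s\<bar> < r \<Longrightarrow> f z \<le> f (z + s *\<^sub>R h)"
  shows "d z h = 0" and "0 \<le> d2 z h h"
proof -
  let ?g = "\<lambda>s. f (z + s *\<^sub>R h)"
  show 1: "d z h = 0"
    using jet_line_derivs(1)[OF j, of z 0 h] S(2) mn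
    by (intro DERIV_local_min[of ?g _ 0 r]) (auto intro: r)
  show "0 \<le> d2 z h h"
  proof (rule ccontr)
    assume neg: "\<not> 0 \<le> d2 z h h"
    have "((\<lambda>s. d (z + s *\<^sub>R h) h) has_real_derivative d2 z h h) (at 0)"
      using jet_line_derivs(2)[OF j, of z 0 h h] S(2) by simp
    \<comment> \<open>With zero first and negative second derivative, the first derivative is
      negative just to the right of \<open>z\<close>; the mean value theorem then makes
      \<open>f\<close> drop below its minimum.\<close>
    from DERIV_neg_dec_right[OF this] neg 1
    obtain r1 where r1: "r1 > 0" "\<And>s. 0 < s \<Longrightarrow> s < r1 \<Longrightarrow> d (z + s *\<^sub>R h) h < 0"
      by auto
    obtain r2 where r2: "r2 > 0" "ball z r2 \<subseteq> S" using S open_contains_ball by blast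
    have pos: "norm h + 1 > 0" by (simp add: add_nonneg_pos)
    then have "0 < min r (min r1 (r2 / (norm h + 1)))" using r r1(1) r2(1) by simp
    from dense[OF this] obtain s where s: "0 < s" "s < r" "s < r1" "s < r2 / (norm h + 1)"
      by auto
    have inS: "z + a *\<^sub>R h \<in> S" if "0 \<le> a" "a \<le> s" for a
    proof -
      have "a * norm h \<le> s * (norm h + 1)" using that s(1) by (intro mult_mono) auto
      also have "\<dots> < r2" using s(4) pos by (simp add: pos_less_divide_eq)
      finally show ?thesis using r2 that by (auto simp: subset_eq dist_norm)
    qed
    have "\<exists>a. 0 < a \<and> a < s \<and> ?g s - ?g 0 = (s - 0) * d (z + a *\<^sub>R h) h"
      by (intro MVT2[OF s(1)] jet_line_derivs(1)[OF j] inS) auto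
    then obtain a where a: "0 < a" "a < s" "?g s - ?g 0 = s * d (z + a *\<^sub>R h) h" by auto
    have "s * d (z + a *\<^sub>R h) h < 0" using a s r1(2)[of a] by (simp add: mult_pos_neg)
    with a(3) mn[of s] s show False by simp
  qed
qed

section \<open>Closure rules for jets\<close>

lemma jet_const: "has_jet S (\<lambda>_. c) (\<lambda>_ _. 0) (\<lambda>_ _ _. 0)"
  by (simp add: has_jet_def)

lemma jet_add:
  assumes "has_jet S f d d2" "has_jet S g e e2"
  shows "has_jet S (\<lambda>z. f z + g z) (\<lambda>z h. d z h + e z h) (\<lambda>z h k. d2 z h k + e2 z h k)"
  unfolding has_jet_def
  by (intro conjI allI ballI has_derivative_add continuous_on_add assms[THEN has_jetD(1)]
      assms[THEN has_jetD(2)] assms[THEN has_jetD(3)])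

lemma jet_cmult:
  assumes "has_jet S f d d2"
  shows "has_jet S (\<lambda>z. c * f z) (\<lambda>z h. c * d z h) (\<lambda>z h k. c * d2 z h k)"
  unfolding has_jet_def
  by (intro conjI allI ballI has_derivative_mult_right continuous_on_mult_left
      assms[THEN has_jetD(1)] assms[THEN has_jetD(2)] assms[THEN has_jetD(3)])

lemma jet_sum:
  assumes "finite I" "\<And>i. i \<in> I \<Longrightarrow> has_jet S (f i) (d i) (d2 i)"
  shows "has_jet S (\<lambda>z. \<Sum>i\<in>I. f i z) (\<lambda>z h. \<Sum>i\<in>I. d i z h) (\<lambda>z h k. \<Sum>i\<in>I. d2 i z h k)"
  using assms
proof (induction I rule: finite_induct)
  case (insert i I)
  then have "has_jet S (f i) (d i) (d2 i)"
    and "has_jet S (\<lambda>z. \<Sum>i\<in>I. f i z) (\<lambda>z h. \<Sum>i\<in>I. d i z h) (\<lambda>z h k. \<Sum>i\<in>I. d2 i z h k)"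
    by simp_all
  from jet_add[OF this] insert.hyps show ?case by simp
qed (simp add: jet_const)

lemma jet_power2:
  assumes "has_jet S f d d2"
  shows "has_jet S (\<lambda>z. (f z)\<^sup>2) (\<lambda>z h. 2 * f z * d z h)
           (\<lambda>z h k. 2 * d z h * d z k + 2 * f z * d2 z h k)"
  unfolding has_jet_def
proof (intro conjI allI ballI)
  fix z k assume "z \<in> S"
  note D = has_jetD(1)[OF assms this] has_jetD(2)[OF assms this]
  show "((\<lambda>z. (f z)\<^sup>2) has_derivative (\<lambda>h. 2 * f z * d z h)) (at z)"
    by (auto intro!: derivative_eq_intros D)
  show "((\<lambda>w. 2 * f w * d w k) has_derivative (\<lambda>h. 2 * d z h * d z k + 2 * f z * d2 z h k)) (at z)"
    by (rule derivative_eq_intros D refl)+ (simp add: algebra_simps)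
qed (intro continuous_intros has_jet_continuous_on[OF assms] has_jetD(3)[OF assms])

text \<open>The expression is quadratic, so its second derivative is constant. It supplies the
  building blocks of the gauge and of the quartic term that makes a maximum strict.\<close>

lemma jet_inner_self:
  fixes L :: "'a::euclidean_space \<Rightarrow> 'b::euclidean_space"
  assumes "linear L"
  shows "has_jet S (\<lambda>z. (L z - c) \<bullet> (L z - c)) (\<lambda>z h. 2 * ((L z - c) \<bullet> L h))
           (\<lambda>z h k. 2 * (L h \<bullet> L k))"
proof -
  have L: "(L has_derivative L) (at z)" for z
    using assms by (simp add: bounded_linear_imp_has_derivative linear_conv_bounded_linear)
  show ?thesis unfolding has_jet_def
    by (intro conjI allI ballI continuous_on_const)
      (auto intro!: derivative_eq_intros L simp: inner_commute)
qed

text \<open>\<open>A\<close> is later either a right translation in space or the projection that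
  freezes the space variable. An affine substitution adds no first order terms to the second
  derivative.\<close>

lemma jet_compose_affine:
  fixes A :: "'a::euclidean_space \<Rightarrow> 'b::euclidean_space"
  assumes j: "has_jet S f d d2" and A: "linear A" and maps: "\<And>z. z \<in> S' \<Longrightarrow> A z + c \<in> S"
  shows "has_jet S' (\<lambda>z. f (A z + c)) (\<lambda>z h. d (A z + c) (A h)) (\<lambda>z h k. d2 (A z + c) (A h) (A k))"
proof -
  have "(A has_derivative A) (at z)" for z
    using A by (simp add: bounded_linear_imp_has_derivative linear_conv_bounded_linear)
  then have D: "((\<lambda>z. A z + c) has_derivative A) (at z)" for z
    by (auto intro!: derivative_eq_intros)
  have cont: "continuous_on S' (\<lambda>z. A z + c)"
    by (intro continuous_at_imp_continuous_on ballI has_derivative_continuous[OF D])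
  show ?thesis unfolding has_jet_def
  proof (intro conjI allI ballI)
    fix h k
    show "continuous_on S' (\<lambda>z. d2 (A z + c) (A h) (A k))"
      by (rule continuous_on_compose2[OF has_jetD(3)[OF j] cont]) (use maps in auto)
  next
    fix z k assume "z \<in> S'"
    note z = maps[OF this]
    show "((\<lambda>z. f (A z + c)) has_derivative (\<lambda>h. d (A z + c) (A h))) (at z)"
      using has_derivative_compose[OF D has_jetD(1)[OF j z]] .
    show "((\<lambda>w. d (A w + c) (A k)) has_derivative (\<lambda>h. d2 (A z + c) (A h) (A k))) (at z)"
      using has_derivative_compose[OF D has_jetD(2)[OF j z]] .
  qed
qed

section \<open>Semicontinuous functions and shrinking infima\<close>

text \<open>The filter \<open>at z within S\<close> omits \<open>z\<close>; including it is harmless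
  because \<open>f z < c\<close> holds there.\<close>

lemma usc_on_metric:
  fixes f :: "'a::metric_space \<Rightarrow> real"
  shows "usc_on S f \<longleftrightarrow> (\<forall>z\<in>S. \<forall>c. f z < c \<longrightarrow> (\<exists>e>0. \<forall>w\<in>S. dist w z < e \<longrightarrow> f w < c))"
proof -
  have "(\<exists>e>0. \<forall>w\<in>S. w \<noteq> z \<and> dist w z < e \<longrightarrow> f w < c) \<longleftrightarrow>
      (\<exists>e>0. \<forall>w\<in>S. dist w z < e \<longrightarrow> f w < c)" if "f z < c" for z c
    using that by (intro ex_cong1 conj_cong refl ball_cong) auto
  then show ?thesis unfolding usc_on_def eventually_at
    by (intro ball_cong refl all_cong1 imp_cong) auto
qed

lemma usc_on_minus:
  assumes "lsc_on S f" shows "usc_on S (\<lambda>z. - f z)"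
  unfolding usc_on_def
proof (intro ballI allI impI)
  fix z c assume "z \<in> S" "- f z < c"
  then have "\<forall>\<^sub>F w in at z within S. - c < f w"
    using assms unfolding lsc_on_def by (metis minus_less_iff)
  then show "\<forall>\<^sub>F w in at z within S. - f w < c"
    by (rule eventually_mono) simp
qed

lemma lsc_on_minus:
  assumes "usc_on S f" shows "lsc_on S (\<lambda>z. - f z)"
  unfolding lsc_on_def
proof (intro ballI allI impI)
  fix z c assume "z \<in> S" "c < - f z"
  then have "\<forall>\<^sub>F w in at z within S. f w < - c"
    using assms unfolding usc_on_def by (metis less_minus_iff)
  then show "\<forall>\<^sub>F w in at z within S. c < - f w"
    by (rule eventually_mono) simp
qed

lemma usc_on_minus_iff: "usc_on S (\<lambda>z. - f z) \<longleftrightarrow> lsc_on S f"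
  using usc_on_minus[of S f] lsc_on_minus[of S "\<lambda>z. - f z"] by auto

lemma usc_on_compose_diff:
  fixes u :: "'a::metric_space \<Rightarrow> real" and p :: "'b::metric_space \<Rightarrow> 'a"
  assumes u: "usc_on S u" and p: "continuous_on K p" "p ` K \<subseteq> S" and g: "continuous_on K g"
  shows "usc_on K (\<lambda>z. u (p z) - g z)"
  unfolding usc_on_metric
proof (intro ballI allI impI)
  fix z c assume z: "z \<in> K" and c: "u (p z) - g z < c"
  define \<epsilon> where "\<epsilon> = (c - (u (p z) - g z)) / 2"
  have \<epsilon>: "\<epsilon> > 0" using c by (simp add: \<epsilon>_def)
  have "u (p z) < u (p z) + \<epsilon>" "p z \<in> S" using \<epsilon> p z by auto
  then obtain e where e: "e > 0" "\<And>w. w \<in> S \<Longrightarrow> dist w (p z) < e \<Longrightarrow> u w < u (p z) + \<epsilon>"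
    using u unfolding usc_on_metric by meson
  obtain e1 where e1: "e1 > 0" "\<And>w. w \<in> K \<Longrightarrow> dist w z < e1 \<Longrightarrow> dist (p w) (p z) < e"
    using p(1) z e(1) unfolding continuous_on_iff by meson
  obtain e2 where e2: "e2 > 0" "\<And>w. w \<in> K \<Longrightarrow> dist w z < e2 \<Longrightarrow> dist (g w) (g z) < \<epsilon>"
    using g z \<epsilon> unfolding continuous_on_iff by meson
  show "\<exists>e>0. \<forall>w\<in>K. dist w z < e \<longrightarrow> u (p w) - g w < c"
  proof (intro exI[of _ "min e1 e2"] conjI ballI impI)
    fix w assume w: "w \<in> K" "dist w z < min e1 e2"
    have "u (p w) < u (p z) + \<epsilon>" using e1(2) e(2) w p(2) by auto
    moreover have "\<bar>g w - g z\<bar> < \<epsilon>" using e2(2) w by (auto simp: dist_real_def)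
    ultimately show "u (p w) - g w < c" unfolding \<epsilon>_def by argo
  qed (use e1 e2 in auto)
qed

lemma usc_on_sublevel_open:
  fixes f :: "'a::metric_space \<Rightarrow> real"
  assumes "usc_on K f"
  shows "\<exists>U. open U \<and> U \<inter> K = {z\<in>K. f z < c}"
proof -
  have "\<forall>z\<in>{z\<in>K. f z < c}. \<exists>e. e > 0 \<and> (\<forall>w\<in>K. dist w z < e \<longrightarrow> f w < c)"
    using assms unfolding usc_on_metric by auto
  from bchoice[OF this] obtain e where
    e: "\<forall>z\<in>{z\<in>K. f z < c}. e z > 0 \<and> (\<forall>w\<in>K. dist w z < e z \<longrightarrow> f w < c)" ..
  let ?U = "\<Union>z\<in>{z\<in>K. f z < c}. ball z (e z)"
  have "w \<in> {z\<in>K. f z < c} \<longleftrightarrow> w \<in> ?U \<inter> K" for w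
  proof
    assume w: "w \<in> {z\<in>K. f z < c}"
    with e have "0 < e w" by blast
    then have "w \<in> ball w (e w)" by simp
    with w show "w \<in> ?U \<inter> K" by blast
  next
    assume "w \<in> ?U \<inter> K"
    then obtain z where z: "z \<in> {z\<in>K. f z < c}" "w \<in> ball z (e z)" "w \<in> K"
      by blast
    from z(2) have "dist w z < e z" by (simp add: dist_commute)
    with z e show "w \<in> {z\<in>K. f z < c}" by blast
  qed
  then have "?U \<inter> K = {z\<in>K. f z < c}" by blast
  moreover have "open ?U" by blast
  ultimately show ?thesis by (intro exI[of _ ?U] conjI)
qed

text \<open>Without a maximum, the sets where \<open>f\<close> lies below one of its own values
  cover \<open>K\<close>. In a finite subcover, the point with the largest value would lie strictly
  below another one.\<close>

lemma usc_on_attains_max: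
  fixes f :: "'a::metric_space \<Rightarrow> real"
  assumes K: "compact K" "K \<noteq> {}" and f: "usc_on K f"
  shows "\<exists>z\<in>K. \<forall>w\<in>K. f w \<le> f z"
proof (rule ccontr)
  assume "\<not> ?thesis"
  then have *: "\<And>z. z \<in> K \<Longrightarrow> \<exists>w\<in>K. f z < f w" by (auto simp: not_le)
  have "\<forall>c. \<exists>U. open U \<and> U \<inter> K = {z\<in>K. f z < c}"
    by (intro allI usc_on_sublevel_open f)
  from choice[OF this] obtain U where U: "\<And>c. open (U c)" "\<And>c. U c \<inter> K = {z\<in>K. f z < c}"
    by auto
  have "K \<subseteq> (\<Union>w\<in>K. U (f w))"
  proof
    fix z assume "z \<in> K"
    then obtain w where "w \<in> K" "f z < f w" using * by blast
    moreover from this \<open>z \<in> K\<close> have "z \<in> U (f w) \<inter> K" by (simp add: U)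
    ultimately show "z \<in> (\<Union>w\<in>K. U (f w))" by blast
  qed
  from compactE_image[OF K(1) U(1) this]
  obtain C where C: "C \<subseteq> K" "finite C" "K \<subseteq> (\<Union>w\<in>C. U (f w))"
    by auto
  have ne: "C \<noteq> {}" using C K by auto
  have "Max (f ` C) \<in> f ` C" using ne C by simp
  then obtain w where w: "w \<in> C" "f w = Max (f ` C)" by auto
  from w C obtain v where v: "v \<in> C" "w \<in> U (f v)" by blast
  have "w \<in> U (f v) \<inter> K" using v w C by blast
  then have "f w < f v" by (simp add: U)
  moreover have "f v \<le> f w" using w v C by simp
  ultimately show False by simp
qed

text \<open>A one-sided Dini theorem: the relatively open sets where \<open>f n\<close> is below
  \<open>c\<close> increase with \<open>n\<close> and cover \<open>K\<close>, so one of them is all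
  of \<open>K\<close>.\<close>

lemma usc_on_dini:
  fixes f :: "nat \<Rightarrow> 'a::metric_space \<Rightarrow> real"
  assumes K: "compact K" and f: "\<And>n. usc_on K (f n)"
    and dec: "\<And>m n z. m \<le> n \<Longrightarrow> z \<in> K \<Longrightarrow> f n z \<le> f m z"
    and ex: "\<And>z. z \<in> K \<Longrightarrow> \<exists>n. f n z < c"
  shows "\<exists>n. \<forall>z\<in>K. f n z < c"
proof -
  have "\<forall>n. \<exists>U. open U \<and> U \<inter> K = {z\<in>K. f n z < c}"
    by (intro allI usc_on_sublevel_open f)
  from choice[OF this] obtain U where U: "\<And>n. open (U n)" "\<And>n. U n \<inter> K = {z\<in>K. f n z < c}"
    by auto
  have "K \<subseteq> (\<Union>n\<in>UNIV. U n)"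
  proof
    fix z assume z: "z \<in> K"
    from ex[OF this] obtain n where "f n z < c" ..
    with z have "z \<in> U n \<inter> K" by (simp add: U)
    then show "z \<in> (\<Union>n\<in>UNIV. U n)" by blast
  qed
  from compactE_image[OF K U(1) this] obtain C where C: "finite C" "K \<subseteq> (\<Union>n\<in>C. U n)"
    by auto
  obtain N where N: "\<And>n. n \<in> C \<Longrightarrow> n \<le> N"
    using Max_ge[OF C(1)] by blast
  have "f N z < c" if z: "z \<in> K" for z
  proof -
    obtain n where n: "n \<in> C" "z \<in> U n" using C z by blast
    then have "z \<in> U n \<inter> K" using z by blast
    then have "f n z < c" by (simp add: U)
    with dec[OF N[OF n(1)] z] show ?thesis by (rule le_less_trans)
  qed
  then show ?thesis by (intro exI[of _ N] ballI)
qed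

text \<open>The bound on \<open>S r0\<close> makes the infima converge; without it \<open>Lim\<close> and \<open>Inf\<close> are unspecified.\<close>

lemma Lim_Inf_shrinking:
  fixes S :: "real \<Rightarrow> real set"
  assumes mono: "\<And>r r'. 0 < r \<Longrightarrow> r \<le> r' \<Longrightarrow> S r \<subseteq> S r'"
    and ne: "\<And>r. 0 < r \<Longrightarrow> S r \<noteq> {}"
    and bd: "0 < r0" "\<And>s. s \<in> S r0 \<Longrightarrow> \<bar>s\<bar> \<le> M"
  obtains l where "((\<lambda>r. Inf (S r)) \<longlongrightarrow> l) (at_right 0)"
    and "\<And>c. l \<le> c \<longleftrightarrow> (\<forall>r>0. \<forall>\<delta>>0. \<exists>s\<in>S r. s < c + \<delta>)"
proof -
  let ?I = "\<lambda>r. Inf (S r)"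
  have bb: "bdd_below (S r)" "\<And>s. s \<in> S r \<Longrightarrow> \<bar>s\<bar> \<le> M" if "0 < r" "r \<le> r0" for r
  proof -
    show *: "\<And>s. s \<in> S r \<Longrightarrow> \<bar>s\<bar> \<le> M" using mono[OF that] bd(2) by blast
    show "bdd_below (S r)" by (rule bdd_belowI[of _ "-M"]) (use * in \<open>force simp: abs_le_iff\<close>)
  qed
  have IM: "?I r \<le> M" if r: "0 < r" "r \<le> r0" for r
  proof -
    obtain s where "s \<in> S r" using ne r by blast
    then show ?thesis using cInf_lower[OF _ bb(1)[OF r]] bb(2)[OF r] by (meson abs_le_D1 order_trans)
  qed
  have Imono: "?I r' \<le> ?I r" if "0 < r" "r \<le> r'" "r' \<le> r0" for r r'
    using that by (intro cInf_superset_mono ne bb mono) auto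
  \<comment> \<open>The infima grow as the radius shrinks, so their limit is this supremum; the
    radii stop at \<open>r0\<close>, up to which the bound \<open>M\<close> applies.\<close>
  define l where "l = (SUP r\<in>{0<..r0}. ?I r)"
  have bdA: "bdd_above (?I ` {0<..r0})" by (rule bdd_aboveI[of _ M]) (use IM in auto)
  have Il: "?I r \<le> l" if "0 < r" "r \<le> r0" for r
    unfolding l_def using that by (intro cSUP_upper bdA) auto
  have near: "\<exists>r. 0 < r \<and> r \<le> r0 \<and> a < ?I r" if "a < l" for a
    using that less_cSUP_iff[OF _ bdA, of a] bd(1) by (auto simp: l_def)
  have 1: "(?I \<longlongrightarrow> l) (at_right 0)"
  proof (rule order_tendstoI)
    fix a assume "a < l"
    then obtain r where r: "0 < r" "r \<le> r0" "a < ?I r" using near by blast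
    have "a < ?I r'" if "0 < r'" "r' < r" for r' using Imono[of r' r] that r by simp
    then show "\<forall>\<^sub>F r in at_right 0. a < ?I r"
      using r(1) unfolding eventually_at_right_field by blast
  next
    fix a assume "l < a"
    then have "?I r' < a" if "0 < r'" "r' < r0" for r' using Il[of r'] that by simp
    then show "\<forall>\<^sub>F r in at_right 0. ?I r < a"
      using bd(1) unfolding eventually_at_right_field by blast
  qed
  have 2: "l \<le> c \<longleftrightarrow> (\<forall>r>0. \<forall>\<delta>>0. \<exists>s\<in>S r. s < c + \<delta>)" for c
  proof (intro iffI allI impI)
    fix r \<delta> :: real assume lc: "l \<le> c" and r: "0 < r" and \<delta>: "0 < \<delta>"
    let ?r = "min r r0"
    have r': "0 < ?r" "?r \<le> r0" using r bd by auto
    have "?I ?r < c + \<delta>" using Il[OF r'] lc \<delta> by simp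
    then obtain s where "s \<in> S ?r" "s < c + \<delta>"
      using cInf_lessD[OF ne[OF r'(1)]] by blast
    then show "\<exists>s\<in>S r. s < c + \<delta>" using mono[OF r'(1), of r] by auto
  next
    assume *: "\<forall>r>0. \<forall>\<delta>>0. \<exists>s\<in>S r. s < c + \<delta>"
    show "l \<le> c"
    proof (rule ccontr)
      assume "\<not> l \<le> c"
      then obtain r where r: "0 < r" "r \<le> r0" "(c + l) / 2 < ?I r" using near[of "(c+l)/2"] by auto
      obtain s where "s \<in> S r" "s < c + (l - c) / 2"
        using * r(1) \<open>\<not> l \<le> c\<close> by (metis diff_gt_0_iff_gt half_gt_zero not_le)
      with cInf_lower[OF _ bb(1)[OF r(1,2)], of s] r(3) show False by (simp add: field_simps)
    qed
  qed
  show ?thesis by (rule that[OF 1 2])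
qed

section \<open>Horizontal derivatives and the envelopes of the operator\<close>

lemma open_Omega: "open Omega"
  by (simp add: Omega_def open_Times)

lemma mem_Omega [simp]: "(x, t) \<in> Omega \<longleftrightarrow> 0 < t"
  by (simp add: Omega_def)

text \<open>The zero second component is time, so these are all spatial directions, not only those
  of the horizontal layer.\<close>

lemma linear_horizontal:
  assumes "linear (f :: (real^'n) \<times> real \<Rightarrow> real)"
  shows "f (h, 0) = (\<Sum>i\<in>UNIV. h $ i * f (axis i 1, 0))"
proof -
  interpret linear f by fact
  have "(h, 0::real) = (\<Sum>i\<in>UNIV. h $ i *\<^sub>R (axis i 1, 0))"
  proof (rule prod_eqI)
    show "fst (h, 0::real) = fst (\<Sum>i\<in>UNIV. h $ i *\<^sub>R (axis i 1 :: real^'n, 0::real))"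
      using basis_expansion[of h] by (simp add: fst_sum scalar_mult_eq_scaleR)
  qed (simp add: snd_sum)
  then show ?thesis by (simp add: sum scaleR del: scaleR_Pair)
qed

lemma grad_inner:
  assumes j: "has_jet Omega \<phi> d d2" and z: "z \<in> Omega"
  shows "grad \<phi> z \<bullet> h = d z (h, 0)"
  unfolding linear_horizontal[OF has_jet_linear(1)[OF j z], of h]
  by (simp add: jet_derivs[OF j open_Omega z] inner_vec_def mult.commute)

text \<open>A jet provides linearity of \<open>d2 z\<close> in its first argument; the expansion in
  the second one goes through Schwarz's theorem.\<close>

lemma hess_inner:
  assumes j: "has_jet Omega \<phi> d d2" and z: "z \<in> Omega"
  shows "h \<bullet> (hess \<phi> z *v k) = d2 z (h, 0) (k, 0)"
proof -
  note sym = jet_symmetric[OF j open_Omega z]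
  have "d2 z (h, 0) (k, 0) = (\<Sum>i\<in>UNIV. h $ i * d2 z (axis i 1, 0) (k, 0))"
    by (rule linear_horizontal[OF has_jet_linear(2)[OF j z]])
  also have "\<dots> = (\<Sum>i\<in>UNIV. h $ i * (\<Sum>j\<in>UNIV. k $ j * d2 z (axis i 1, 0) (axis j 1, 0)))"
    by (simp add: sym[of "(axis _ 1, 0)" "(k, 0)"] linear_horizontal[OF has_jet_linear(2)[OF j z], of k])
      (simp add: sym)
  finally show ?thesis
    by (simp add: jet_derivs[OF j open_Omega z] inner_vec_def matrix_vector_mult_def mult.commute)
qed

lemma symm_hess:
  assumes j: "has_jet Omega \<phi> d d2" and z: "z \<in> Omega"
  shows "symm (hess \<phi> z)"
  using jet_symmetric[OF j open_Omega z]
  by (simp add: symm_def jet_derivs[OF j open_Omega z] transpose_def vec_eq_iff)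

lemma Xgrad_inner:
  assumes "has_jet Omega \<phi> d d2" "z \<in> Omega"
  shows "Xgrad B \<phi> z \<bullet> v = d z (sigma B (fst z) *v v, 0)"
  by (simp add: Xgrad_def dot_lmul_matrix grad_inner[OF assms])

lemma sandwich_inner:
  fixes A :: "real^'n::finite^'n" and S :: "real^'m::finite^'n"
  shows "v \<bullet> ((transpose S ** A ** S) *v w) = (S *v v) \<bullet> (A *v (S *v w))"
  using dot_lmul_matrix[of v "transpose S" "A *v (S *v w)"]
  by (simp add: matrix_vector_mul_assoc[symmetric])

lemma Xhess_inner:
  assumes "has_jet Omega \<phi> d d2" "z \<in> Omega"
  shows "v \<bullet> (Xhess B \<phi> z *v w) = d2 z (sigma B (fst z) *v v, 0) (sigma B (fst z) *v w, 0)"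
  by (simp add: Xhess_def sandwich_inner hess_inner[OF assms])

lemma symm_sandwich:
  assumes "symm A" shows "symm (transpose S ** A ** S)"
  using assms by (simp add: symm_def matrix_transpose_mul transpose_transpose matrix_mul_assoc)

lemma matrix_eq_0_iff_inner:
  fixes A :: "real^'n^'m"
  shows "A = 0 \<longleftrightarrow> (\<forall>v w. v \<bullet> (A *v w) = 0)"
proof
  assume "\<forall>v w. v \<bullet> (A *v w) = 0"
  then have "A *v w = 0" for w using inner_eq_zero_iff by blast
  then show "A = 0" by (metis matrix_eq matrix_vector_mult_0)
qed simp

lemma sigma_mult_nth:
  "(sigma B x *v v) $ Inl i = v $ i"
  "(sigma B x *v v) $ Inr k = (B k *v hpart x) \<bullet> v"
proof -
  have "(\<Sum>j\<in>UNIV. (if i = j then 1 else 0) * v $ j) = (\<Sum>j\<in>UNIV. if j = i then v $ j else 0)"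
    by (rule sum.cong) auto
  then show "(sigma B x *v v) $ Inl i = v $ i"
    by (simp add: sigma_def matrix_vector_mult_def)
  show "(sigma B x *v v) $ Inr k = (B k *v hpart x) \<bullet> v"
    by (simp add: sigma_def matrix_vector_mult_def[of "sigma B x" v] inner_vec_def
        matrix_vector_mult_def[of "\<chi> r j. case r of Inl i \<Rightarrow> if i = j then 1 else 0 | Inr k \<Rightarrow> (B k *v hpart x) $ j"])
qed

text \<open>The rows \<open>Inl i\<close> of \<open>sigma\<close> form the identity. This gives a
  covector perturbation whose horizontal part is the same at every base point.\<close>

lemma axis_sigma:
  "axis (Inl i) c v* sigma B x = axis i (c::real)"
proof (rule vector_eq_rdot[THEN iffD1], rule allI)
  fix v show "(axis (Inl i) c v* sigma B x) \<bullet> v = axis i c \<bullet> v"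
    by (simp add: dot_lmul_matrix inner_axis' sigma_mult_nth)
qed

section \<open>Values of the operator near a point\<close>

definition G_values :: "('m::finite, 'k::finite) Fop \<Rightarrow> ('k \<Rightarrow> real^'m^'m) \<Rightarrow>
    real^('m+'k) \<Rightarrow> real \<Rightarrow> real^('m+'k) \<Rightarrow> real^('m+'k)^('m+'k) \<Rightarrow> real \<Rightarrow> real set" where
  "G_values F B x t p A r = {Gop F B y s q C | y s q C.
      q v* sigma B y \<noteq> 0 \<and> 0 < s \<and> symm C \<and> norm (x - y, t - s, p - q, A - C) \<le> r}"

text \<open>When \<open>p v* sigma B x\<close> vanishes the point itself is inadmissible; adding
  \<open>r\<close> along a horizontal axis makes the horizontal part nonzero and stays within
  distance \<open>r\<close>.\<close>

lemma G_values_nonempty: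
  assumes "0 < t" "symm A" "0 < r"
  shows "G_values F B x t p A r \<noteq> {}"
proof (cases "p v* sigma B x = 0")
  case True
  fix i :: 'a
  have "(p + axis (Inl i) r) v* sigma B x = axis i r"
    using True by (simp add: vector_matrix_left_distrib axis_sigma)
  moreover have "norm (x - x, t - t, p - (p + axis (Inl i) r), A - A) \<le> r"
    using assms(3) by (simp add: norm_Pair norm_eq_sqrt_inner inner_axis_axis)
  ultimately have "Gop F B x t (p + axis (Inl i) r) A \<in> G_values F B x t p A r"
    using assms unfolding G_values_def by (force simp: axis_eq_0_iff)
  then show ?thesis by blast
next
  case False
  have "Gop F B x t p A \<in> G_values F B x t p A r"
    using assms False unfolding G_values_def by (fastforce simp: norm_Pair)
  then show ?thesis by blast
qed

lemma G_values_mono: "r \<le> r' \<Longrightarrow> G_values F B x t p A r \<subseteq> G_values F B x t p A r'"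
  unfolding G_values_def by fastforce

text \<open>The entries of \<open>sigma\<close> are affine in the point, so every component is
  polynomial.\<close>

lemma continuous_Gop_arg:
  fixes B :: "'k::finite \<Rightarrow> real^'m::finite^'m"
  shows "isCont (\<lambda>(y, s, q, C). (y, s::real, q v* sigma B y, transpose (sigma B y) ** C ** sigma B y)) w"
proof -
  have s: "continuous_on UNIV (\<lambda>w. sigma B (fst w) $ r $ j)" for r j
    unfolding sigma_def hpart_def matrix_vector_mult_def
    by (cases r) (auto intro!: continuous_intros)
  have "continuous_on UNIV (\<lambda>w :: (real^('m+'k)) \<times> real \<times> _. (fst w, fst (snd w) :: real, fst (snd (snd w)) v* sigma B (fst w),
      transpose (sigma B (fst w)) ** snd (snd (snd w)) ** sigma B (fst w)))"
    unfolding vector_matrix_mult_def matrix_matrix_mult_def transpose_def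
    by (simp, intro continuous_intros s)
  then show ?thesis
    by (simp add: continuous_on_eq_continuous_at case_prod_unfold del: split_paired_All)
qed

text \<open>Continuity of the arguments passed to \<open>F\<close> turns a property of
  \<open>F\<close> near the limiting arguments into one of all values of \<open>G\<close> near the
  point, whether or not \<open>p v* sigma B x\<close> vanishes.\<close>

lemma G_values_near:
  assumes \<rho>: "\<rho> > 0" and P: "\<And>y s q C. 0 < s \<Longrightarrow> q \<noteq> 0 \<Longrightarrow> symm C \<Longrightarrow>
      norm ((y, s, q, C) - (x, t, p v* sigma B x, transpose (sigma B x) ** A ** sigma B x)) < \<rho> \<Longrightarrow>
      P (F y s q C)"
  shows "\<exists>r>0. \<forall>g\<in>G_values F B x t p A r. P g"
proof -
  obtain e where e: "e > 0" "\<And>w. dist w (x, t, p, A) < e \<Longrightarrow>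
      dist ((\<lambda>(y, s, q, C). (y, s::real, q v* sigma B y, transpose (sigma B y) ** C ** sigma B y)) w)
        (x, t, p v* sigma B x, transpose (sigma B x) ** A ** sigma B x) < \<rho>"
    using continuous_Gop_arg[of "(x, t, p, A)" B] \<rho> unfolding continuous_at_eps_delta by auto
  show ?thesis
  proof (intro exI[of _ "e/2"] conjI ballI)
    fix g assume "g \<in> G_values F B x t p A (e/2)"
    then obtain y s q C where g: "g = Gop F B y s q C" "q v* sigma B y \<noteq> 0" "0 < s" "symm C"
      and n: "norm (x - y, t - s, p - q, A - C) \<le> e/2"
      unfolding G_values_def by blast
    have "dist (y, s, q, C) (x, t, p, A) < e"
      using n e(1) using norm_minus_commute[of "(y, s, q, C)" "(x, t, p, A)"] by (simp add: dist_norm)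
    from e(2)[OF this] have "norm ((y, s, q v* sigma B y, transpose (sigma B y) ** C ** sigma B y) -
        (x, t, p v* sigma B x, transpose (sigma B x) ** A ** sigma B x)) < \<rho>"
      by (simp only: dist_norm split_conv)
    then show "P g"
      unfolding g(1) Gop_def by (intro P symm_sandwich g(2-4))
  qed (use e in simp)
qed

lemma F_near:
  assumes "F_standing F" "0 < t" "q \<noteq> 0" "symm A" "\<delta> > 0"
  shows "\<exists>\<rho>>0. \<forall>y s p C. 0 < s \<longrightarrow> p \<noteq> 0 \<longrightarrow> symm C \<longrightarrow> norm ((y, s, p, C) - (x, t, q, A)) < \<rho> \<longrightarrow>
     \<bar>F y s p C - F x t q A\<bar> < \<delta>"
proof -
  have "continuous_on {(x, t, q, A). 0 < t \<and> q \<noteq> 0 \<and> symm A} (\<lambda>(x, t, q, A). F x t q A)"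
    using assms(1) by (simp add: F_standing_def)
  from this[unfolded continuous_on_iff, rule_format, of "(x, t, q, A)" \<delta>] assms(2-5)
  obtain \<rho> where \<rho>: "\<rho> > 0" and c: "\<And>w. w \<in> {(x, t, q, A). 0 < t \<and> q \<noteq> 0 \<and> symm A} \<Longrightarrow>
      dist w (x, t, q, A) < \<rho> \<Longrightarrow> dist ((\<lambda>(x, t, q, A). F x t q A) w) (F x t q A) < \<delta>"
    by auto
  show ?thesis
  proof (intro exI[of _ \<rho>] conjI allI impI \<rho>)
    fix y s p C
    assume "0 < s" "p \<noteq> 0" "symm C" "norm ((y, s, p, C) - (x, t, q, A)) < \<rho>"
    then show "\<bar>F y s p C - F x t q A\<bar> < \<delta>"
      using c[of "(y, s, p, C)"] by (simp only: dist_norm real_norm_def split_conv mem_Collect_eq simp_thms)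
  qed
qed

text \<open>Scaling \<open>(p, C)\<close> by \<open>l\<close> multiplies \<open>F\<close> by
  \<open>l\<close>, so a bound \<open>M\<close> at norm \<open>r / 2\<close> becomes
  \<open>M / l\<close> at the original, small norm. Local boundedness thus improves to the limit
  zero.\<close>

lemma F_near_zero:
  fixes F :: "('m::finite, 'k::finite) Fop"
  assumes st: "F_standing F" and F3: "F3 F" and t: "0 < t" and \<delta>: "\<delta> > 0"
  shows "\<exists>\<rho>>0. \<forall>y s p C. 0 < s \<longrightarrow> p \<noteq> 0 \<longrightarrow> symm C \<longrightarrow> norm ((y, s, p, C) - (x, t, 0, 0)) < \<rho> \<longrightarrow>
     \<bar>F y s p C\<bar> < \<delta>"
proof -
  have "symm 0" by (simp add: symm_def transpose_def vec_eq_iff)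
  with st t have "\<exists>r>0. \<exists>M. \<forall>y s q C. 0 < s \<and> q \<noteq> 0 \<and> symm C \<and>
      norm ((y, s, q, C) - (x, t, 0, 0)) < r \<longrightarrow> \<bar>F y s q C\<bar> \<le> M"
    unfolding F_standing_def by blast
  then obtain r M where r: "r > 0" and M0: "\<forall>y s q C. 0 < s \<and> q \<noteq> 0 \<and> symm C \<and>
      norm ((y, s, q, C) - (x, t, 0, 0)) < r \<longrightarrow> \<bar>F y s q C\<bar> \<le> M" by blast
  have M: "\<bar>F y s q C\<bar> \<le> M"
    if "0 < s" "q \<noteq> 0" "symm C" "norm ((y, s, q, C) - (x, t, 0, 0)) < r" for y s q C
    using M0 that by blast
  \<comment> \<open>The first bound keeps the rescaled point within \<open>r\<close> of the centre;
    the second makes \<open>M * norm (p, C) * 2 / r\<close> less than \<open>\<delta>\<close>. Using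
    \<open>\<bar>M\<bar> + 1\<close> keeps the denominator positive.\<close>
  define \<rho> where "\<rho> = min (r/2) (\<delta> * r / (2 * (\<bar>M\<bar> + 1)))"
  have \<rho>: "\<rho> > 0" using r \<delta> by (simp add: \<rho>_def)
  show ?thesis
  proof (intro exI[of _ \<rho>] conjI allI impI \<rho>)
    fix y s and p :: "real^'m" and C :: "real^'m^'m" assume s: "0 < s" "p \<noteq> 0" "symm C" and n: "norm ((y, s, p, C) - (x, t, 0, 0)) < \<rho>"
    \<comment> \<open>rescale \<open>(p, C)\<close> to norm \<open>r / 2\<close>, where \<open>F\<close> is bounded by \<open>M\<close>\<close>
    define m where "m = norm (p, C)"
    have m: "m > 0" using s by (simp add: m_def zero_prod_def)
    have mr: "m < \<rho>"
      using n norm_snd_le[of "(p, C)" "s - t"] norm_snd_le[of "(s - t, p, C)" "y - x"]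
      by (simp add: m_def)
    define l where "l = r / 2 / m"
    have l: "l > 0" using r m by (simp add: l_def)
    have "norm ((y, s, l *\<^sub>R p, l *\<^sub>R C) - (x, t, 0, 0)) =
        norm ((y - x, s - t, 0::real^'m, 0::real^'m^'m) + (0, 0, l *\<^sub>R (p, C)))" by simp
    also have "\<dots> \<le> norm (y - x, s - t, 0::real^'m, 0::real^'m^'m) + norm (0::real^('m+'k), 0::real, l *\<^sub>R (p, C))"
      by (rule norm_triangle_ineq)
    also have "norm (0::real^('m+'k), 0::real, l *\<^sub>R (p, C)) = l * m"
      using l by (simp add: m_def norm_Pair del: scaleR_Pair)
    also have "l * m = r / 2" using m by (simp add: l_def)
    also have "norm (y - x, s - t, 0::real^'m, 0::real^'m^'m) \<le> norm ((y, s, p, C) - (x, t, 0, 0))"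
      by (simp add: norm_Pair)
    also have "norm ((y, s, p, C) - (x, t, 0, 0)) < r / 2" using n by (simp add: \<rho>_def)
    finally have "norm ((y, s, l *\<^sub>R p, l *\<^sub>R C) - (x, t, 0, 0)) < r" by simp
    then have "\<bar>F y s (l *\<^sub>R p) (l *\<^sub>R C)\<bar> \<le> M"
      using s l by (intro M) (auto simp: symm_def transpose_scalar)
    moreover have "F y s (l *\<^sub>R p) (l *\<^sub>R C) = l * F y s p C"
      using F3[unfolded F3_def, rule_format, of s p C l y 0] s l by simp
    ultimately have "l * \<bar>F y s p C\<bar> \<le> M" using l by (simp add: abs_mult)
    then have "\<bar>F y s p C\<bar> \<le> M / l" using l by (simp add: field_simps)
    also have "\<dots> = M * m * 2 / r" by (simp add: l_def)
    also have "\<dots> \<le> (\<bar>M\<bar> + 1) * m * 2 / r"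
      using m r by (intro divide_right_mono mult_right_mono) auto
    also have "\<dots> < (\<bar>M\<bar> + 1) * (\<delta> * r / (2 * (\<bar>M\<bar> + 1))) * 2 / r"
      using mr r by (intro divide_strict_right_mono mult_strict_right_mono mult_strict_left_mono)
        (auto simp: \<rho>_def)
    also have "\<dots> = \<delta>"
    proof -
      have "k * (\<delta> * r / (2 * k)) * 2 / r = \<delta>" if "k > 0" for k using that r by simp
      from this[of "\<bar>M\<bar> + 1"] show ?thesis by arith
    qed
    finally show "\<bar>F y s p C\<bar> < \<delta>" .
  qed
qed

text \<open>The standing assumption gives a bound where the horizontal part of \<open>p\<close>
  vanishes, continuity of \<open>F\<close> gives it elsewhere. It makes the limit defining
  \<open>G_lower\<close> exist.\<close>

lemma G_values_bounded:
  assumes st: "F_standing F" and t: "0 < t" and A: "symm A"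
  shows "\<exists>r>0. \<exists>M. \<forall>g\<in>G_values F B x t p A r. \<bar>g\<bar> \<le> M"
proof -
  let ?p = "p v* sigma B x" and ?A = "transpose (sigma B x) ** A ** sigma B x"
  have A': "symm ?A" using A by (rule symm_sandwich)
  have "\<exists>\<rho>>0. \<exists>M. \<forall>y s q C. 0 < s \<longrightarrow> q \<noteq> 0 \<longrightarrow> symm C \<longrightarrow> norm ((y, s, q, C) - (x, t, ?p, ?A)) < \<rho>
      \<longrightarrow> \<bar>F y s q C\<bar> \<le> M"
  proof (cases "?p = 0")
    case True
    from st t A' have "\<exists>r>0. \<exists>M. \<forall>y s q C. 0 < s \<and> q \<noteq> 0 \<and> symm C \<and>
        norm ((y, s, q, C) - (x, t, 0, ?A)) < r \<longrightarrow> \<bar>F y s q C\<bar> \<le> M"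
      unfolding F_standing_def by blast
    then show ?thesis unfolding True by (simp only: imp_conjL)
  next
    case False
    obtain \<rho> where \<rho>: "\<rho> > 0" and b: "\<forall>y s p C. 0 < s \<longrightarrow> p \<noteq> 0 \<longrightarrow> symm C \<longrightarrow>
        norm ((y, s, p, C) - (x, t, ?p, ?A)) < \<rho> \<longrightarrow> \<bar>F y s p C - F x t ?p ?A\<bar> < 1"
      using F_near[OF st t False A' zero_less_one, of x] by blast
    have "\<bar>F y s q C\<bar> \<le> \<bar>F x t ?p ?A\<bar> + 1"
      if "0 < s" "q \<noteq> 0" "symm C" "norm ((y, s, q, C) - (x, t, ?p, ?A)) < \<rho>" for y s q C
    proof -
      have "\<bar>F y s q C - F x t ?p ?A\<bar> < 1" using b that by blast
      then show ?thesis by arith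
    qed
    with \<rho> show ?thesis by (intro exI[of _ \<rho>] exI[of _ "\<bar>F x t ?p ?A\<bar> + 1"] conjI allI impI)
  qed
  then obtain \<rho> M where "\<rho> > 0" "\<And>y s q C. 0 < s \<Longrightarrow> q \<noteq> 0 \<Longrightarrow> symm C \<Longrightarrow>
      norm ((y, s, q, C) - (x, t, ?p, ?A)) < \<rho> \<Longrightarrow> \<bar>F y s q C\<bar> \<le> M" by blast
  from G_values_near[of \<rho> x t p B A "\<lambda>g. \<bar>g\<bar> \<le> M" F, OF this] show ?thesis by blast
qed

text \<open>The second form replaces the limit of infima in comparisons with a number; the limit
  itself serves the passage to \<open>G_upper\<close>.\<close>

lemma G_lower_limit:
  assumes st: "F_standing F" and t: "0 < t" and A: "symm A"
  shows "((\<lambda>r. Inf (G_values F B x t p A r)) \<longlongrightarrow> G_lower F B x t p A) (at_right 0)"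
    and "G_lower F B x t p A \<le> c \<longleftrightarrow> (\<forall>r>0. \<forall>\<delta>>0. \<exists>g\<in>G_values F B x t p A r. g < c + \<delta>)"
proof -
  obtain r0 M where r0: "r0 > 0" "\<And>g. g \<in> G_values F B x t p A r0 \<Longrightarrow> \<bar>g\<bar> \<le> M"
    using G_values_bounded[OF assms] by blast
  obtain l where l: "((\<lambda>r. Inf (G_values F B x t p A r)) \<longlongrightarrow> l) (at_right 0)"
    "\<And>c. l \<le> c \<longleftrightarrow> (\<forall>r>0. \<forall>\<delta>>0. \<exists>g\<in>G_values F B x t p A r. g < c + \<delta>)"
    using Lim_Inf_shrinking[of "G_values F B x t p A" r0 M,
        OF G_values_mono G_values_nonempty[OF t A] r0] by blast
  have "G_lower F B x t p A = l"
    unfolding G_lower_def G_values_def[symmetric] using l(1) by (intro tendsto_Lim) simp_all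
  with l show "((\<lambda>r. Inf (G_values F B x t p A r)) \<longlongrightarrow> G_lower F B x t p A) (at_right 0)"
    and "G_lower F B x t p A \<le> c \<longleftrightarrow> (\<forall>r>0. \<forall>\<delta>>0. \<exists>g\<in>G_values F B x t p A r. g < c + \<delta>)"
    by simp_all
qed

section \<open>Sign reversal and the dual operator\<close>

definition dual_op :: "('m::finite, 'k::finite) Fop \<Rightarrow> ('m, 'k) Fop" where
  "dual_op F x t p A = - F x t (- p) (- A)"

lemma symm_minus [simp]: "symm (- A) \<longleftrightarrow> symm A"
  by (simp add: symm_def transpose_def vec_eq_iff)

lemma F_standing_dual:
  assumes "F_standing F" shows "F_standing (dual_op F)"
proof -
  let ?D = "{(x, t, q, A). 0 < t \<and> q \<noteq> 0 \<and> symm A}"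
  have "continuous_on ?D (\<lambda>(x, t, q, A). F x t q A)" using assms by (simp add: F_standing_def)
  then have "continuous_on ?D (\<lambda>w. (\<lambda>(x, t, q, A). F x t q A) ((\<lambda>(x, t, q, A). (x, t, - q, - A)) w))"
    by (rule continuous_on_compose2)
      (auto simp: case_prod_beta intro!: continuous_intros)
  then have "continuous_on ?D (\<lambda>(x, t, q, A). dual_op F x t q A)"
    unfolding dual_op_def by (simp add: case_prod_beta continuous_on_minus)
  moreover have "\<exists>r>0. \<exists>M. \<forall>y s q C.
      0 < s \<and> q \<noteq> 0 \<and> symm C \<and> norm ((y, s, q, C) - (x, t, 0, A)) < r \<longrightarrow> \<bar>dual_op F y s q C\<bar> \<le> M"
    if "0 < t" "symm A" for x t A
  proof -
    have "symm (- A)" using that by simp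
    with assms that(1) have "\<exists>r>0. \<exists>M. \<forall>y s q C. 0 < s \<and> q \<noteq> 0 \<and> symm C \<and>
        norm ((y, s, q, C) - (x, t, 0, - A)) < r \<longrightarrow> \<bar>F y s q C\<bar> \<le> M"
      unfolding F_standing_def by blast
    then obtain r M where r: "r > 0" and M: "\<forall>y s q C. 0 < s \<and> q \<noteq> 0 \<and> symm C \<and>
        norm ((y, s, q, C) - (x, t, 0, - A)) < r \<longrightarrow> \<bar>F y s q C\<bar> \<le> M" by blast
    have "\<bar>dual_op F y s q C\<bar> \<le> M"
      if "0 < s" "q \<noteq> 0" "symm C" "norm ((y, s, q, C) - (x, t, 0, A)) < r" for y s q C
    proof -
      have "norm ((y, s, - q, - C) - (x, t, 0, - A)) = norm ((y, s, q, C) - (x, t, 0, A))"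
        by (simp add: norm_Pair norm_minus_commute)
      with that have "\<bar>F y s (- q) (- C)\<bar> \<le> M"
        by (intro M[rule_format]) simp
      then show ?thesis by (simp add: dual_op_def)
    qed
    with r show ?thesis by (metis (lifting))
  qed
  ultimately show ?thesis unfolding F_standing_def by blast
qed

lemma F2_dual:
  assumes "F2 F" shows "F2 (dual_op F)"
  unfolding F2_def
proof (intro allI impI)
  fix x and t :: real and p :: "real^'a" and A C :: "real^'a^'a" assume *: "0 < t \<and> p \<noteq> 0 \<and> symm A \<and> symm C \<and> psd (A - C)"
  then have "F x t (- p) (- C) \<le> F x t (- p) (- A)"
    using assms[unfolded F2_def, rule_format, of t "- p" "- C" "- A" x] by simp
  then show "dual_op F x t p A \<le> dual_op F x t p C" by (simp add: dual_op_def)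
qed

text \<open>\<open>outer\<close> is even in \<open>p\<close> while the matrix argument changes sign,
  so the coefficient \<open>\<mu>\<close> enters (F3) for \<open>F\<close> as
  \<open>- \<mu>\<close>.\<close>

lemma F3_dual:
  assumes "F3 F" shows "F3 (dual_op F)"
  unfolding F3_def
proof (intro allI impI)
  fix x and t :: real and p :: "real^'a" and A :: "real^'a^'a" and l \<mu> :: real assume *: "0 < t \<and> p \<noteq> 0 \<and> symm A \<and> 0 < l"
  have "outer (- p) = outer p" by (simp add: outer_def)
  then have "F x t (l *\<^sub>R (- p)) (l *\<^sub>R (- A) + (- \<mu>) *\<^sub>R outer p) = l * F x t (- p) (- A)"
    using assms[unfolded F3_def, rule_format, of t "- p" "- A" l x "- \<mu>"] * by simp
  then show "dual_op F x t (l *\<^sub>R p) (l *\<^sub>R A + \<mu> *\<^sub>R outer p) = l * dual_op F x t p A"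
    by (simp add: dual_op_def)
qed

lemma G_values_dual:
  "G_values (dual_op F) B x t p A r = uminus ` G_values F B x t (- p) (- A) r"
proof -
  have m: "(- q) v* S = - (q v* S)" for q and S :: "real^'a^('a+'b)"
    by (simp add: vector_matrix_mult_def vec_eq_iff sum_negf)
  have "transpose S ** (- C) ** S = - (transpose S ** C ** S)" for C and S :: "real^'a^('a+'b)"
    by (simp add: matrix_matrix_mult_def vec_eq_iff sum_negf)
  with m have *: "Gop (dual_op F) B y s q C = - Gop F B y s (- q) (- C)" for y s q C
    by (simp add: Gop_def dual_op_def)
  have n: "norm (x - y, t - s, - p - - q, - A - - C) = norm (x - y, t - s, p - q, A - C)" for y s q C
    by (simp add: norm_Pair norm_minus_commute)
  show ?thesis
  proof (intro equalityI subsetI)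
    fix g assume "g \<in> G_values (dual_op F) B x t p A r"
    then obtain y s q C where "g = - Gop F B y s (- q) (- C)" "q v* sigma B y \<noteq> 0" "0 < s" "symm C"
      "norm (x - y, t - s, p - q, A - C) \<le> r" unfolding G_values_def * by blast
    then have "Gop F B y s (- q) (- C) \<in> G_values F B x t (- p) (- A) r"
      unfolding G_values_def using n[of y s q C] m[of q "sigma B y"]
      by (intro CollectI exI[of _ y] exI[of _ s] exI[of _ "- q"] exI[of _ "- C"]) simp
    then show "g \<in> uminus ` G_values F B x t (- p) (- A) r" using \<open>g = _\<close> by blast
  next
    fix g assume "g \<in> uminus ` G_values F B x t (- p) (- A) r"
    then obtain y s q C where g: "g = - Gop F B y s q C" "q v* sigma B y \<noteq> 0" "0 < s" "symm C"
      "norm (x - y, t - s, - p - q, - A - C) \<le> r" unfolding G_values_def by blast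
    then have "Gop (dual_op F) B y s (- q) (- C) \<in> G_values (dual_op F) B x t p A r"
      unfolding G_values_def using n[of y s "- q" "- C"] m[of q "sigma B y"]
      by (intro CollectI exI[of _ y] exI[of _ s] exI[of _ "- q"] exI[of _ "- C"]) simp
    then show "g \<in> G_values (dual_op F) B x t p A r" using g(1) by (simp add: *)
  qed
qed

lemma G_upper_dual:
  assumes st: "F_standing F" and t: "0 < t" and A: "symm A"
  shows "G_upper F B x t p A = - G_lower (dual_op F) B x t (- p) (- A)"
proof -
  have "((\<lambda>r. - Inf (G_values (dual_op F) B x t (- p) (- A) r)) \<longlongrightarrow>
      - G_lower (dual_op F) B x t (- p) (- A)) (at_right 0)"
    by (intro tendsto_minus G_lower_limit(1) F_standing_dual st t) (simp add: A)
  \<comment> \<open>\<open>Inf\<close> on the reals is by definition minus the \<open>Sup\<close> of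
    the negated set, so the two approximations agree at every radius.\<close>
  moreover have "- Inf (G_values (dual_op F) B x t (- p) (- A) r) = Sup (G_values F B x t p A r)" for r
    by (simp add: G_values_dual Inf_real_def image_image)
  ultimately show ?thesis
    unfolding G_upper_def G_values_def[symmetric] by (intro tendsto_Lim) simp_all
qed

section \<open>A left invariant gauge\<close>

text \<open>In terms of the group law, \<open>disp B x y\<close> is \<open>y\<inverse> \<circ> x\<close>, \<open>shift B \<eta> h - \<eta>\<close> is
  \<open>h \<circ> \<eta>\<inverse>\<close> (so \<open>shift B \<eta>\<close> is the linear part of a right translation), and \<open>gauge B y x\<close> is
  \<open>\<psi> (y\<inverse> \<circ> x)\<close>.\<close>

definition gauge_lin :: "('k::finite \<Rightarrow> real^'m::finite^'m) \<Rightarrow> real^('m + 'k) \<Rightarrow> 'k \<Rightarrow> real^('m + 'k) \<Rightarrow> real" where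
  "gauge_lin B y k h = h $ Inr k - (B k *v hpart y) \<bullet> hpart h"

definition disp :: "('k::finite \<Rightarrow> real^'m::finite^'m) \<Rightarrow> real^('m + 'k) \<Rightarrow> real^('m + 'k) \<Rightarrow> real^('m + 'k)" where
  "disp B x y = (\<chi> r. case r of Inl i \<Rightarrow> x $ Inl i - y $ Inl i | Inr k \<Rightarrow> gauge_lin B y k x - y $ Inr k)"

definition shift :: "('k::finite \<Rightarrow> real^'m::finite^'m) \<Rightarrow> real^('m + 'k) \<Rightarrow> real^('m + 'k) \<Rightarrow> real^('m + 'k)" where
  "shift B \<eta> h = (\<chi> r. case r of Inl i \<Rightarrow> h $ Inl i | Inr k \<Rightarrow> h $ Inr k - (B k *v hpart h) \<bullet> hpart \<eta>)"

definition gauge :: "('k::finite \<Rightarrow> real^'m::finite^'m) \<Rightarrow> real^('m + 'k) \<Rightarrow> real^('m + 'k) \<Rightarrow> real" where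
  "gauge B y x = (hpart (disp B x y) \<bullet> hpart (disp B x y))\<^sup>2 + (\<Sum>k\<in>UNIV. (disp B x y $ Inr k)\<^sup>2)"

lemma vec_sum_eq_iff: "x = y \<longleftrightarrow> (\<forall>i. x $ Inl i = y $ Inl i) \<and> (\<forall>k. x $ Inr k = y $ Inr k)"
  by (auto simp: vec_eq_iff split: sum.splits) (metis sum.exhaust)

lemma hpart_simps [simp]:
  "hpart x $ i = x $ Inl i"
  "hpart (x + y) = hpart x + hpart y" "hpart (x - y) = hpart x - hpart y"
  "hpart (c *\<^sub>R x) = c *\<^sub>R hpart x" "hpart 0 = 0" "hpart (- x) = - hpart x"
  "hpart (sigma B x *v v) = v" "hpart (shift B \<eta> x) = hpart x"
  "hpart (disp B x y) = hpart x - hpart y"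
  by (simp_all add: hpart_def vec_eq_iff sigma_mult_nth shift_def disp_def)

lemma disp_nth:
  "disp B x y $ Inl i = x $ Inl i - y $ Inl i"
  "disp B x y $ Inr k = gauge_lin B y k x - y $ Inr k"
  by (simp_all add: disp_def)

lemma shift_nth:
  "shift B \<eta> h $ Inl i = h $ Inl i"
  "shift B \<eta> h $ Inr k = h $ Inr k - (B k *v hpart h) \<bullet> hpart \<eta>"
  by (simp_all add: shift_def)

lemma skew_inner:
  fixes B :: "real^'m^'m"
  assumes "transpose B = - B"
  shows "(B *v a) \<bullet> b = - ((B *v b) \<bullet> a)"
proof -
  have "(B *v a) \<bullet> b = a \<bullet> (transpose B *v b)"
    by (metis dot_lmul_matrix inner_commute vector_transpose_matrix transpose_transpose)
  also have "\<dots> = - ((B *v b) \<bullet> a)"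
    by (simp add: assms inner_commute matrix_vector_mult_def inner_vec_def sum_negf)
  finally show ?thesis .
qed

lemma skew_inner_self:
  fixes B :: "real^'m^'m"
  assumes "transpose B = - B" shows "(B *v a) \<bullet> a = 0"
  using skew_inner[OF assms, of a a] by simp

lemma disp_self:
  assumes "\<And>k. transpose (B k) = - B k" shows "disp B x x = 0"
  by (simp add: vec_sum_eq_iff disp_def gauge_lin_def skew_inner_self[OF assms])

lemma shift_zero [simp]: "shift B 0 h = h"
  by (simp add: vec_sum_eq_iff shift_def)

text \<open>This is the group identity
  \<open>x \<circ> (y\<inverse> \<circ> x)\<inverse> = y\<close>; in coordinates the quadratic terms
  cancel because each \<open>B k\<close> is skew.\<close>

lemma shift_disp:
  assumes "\<And>k. transpose (B k) = - B k"
  shows "shift B (disp B x y) x - disp B x y = y"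
  using skew_inner_self[OF assms] skew_inner[OF assms, of _ "hpart y" "hpart x"]
  by (simp add: vec_sum_eq_iff shift_nth disp_nth gauge_lin_def inner_diff_right)

text \<open>With \<open>y\<close> tied to \<open>x\<close> as
  \<open>x \<circ> \<eta>\<inverse>\<close>, the displacement \<open>y\<inverse> \<circ> x\<close>
  stays equal to \<open>\<eta>\<close>, so the penalty is constant along this motion.\<close>

lemma disp_shift:
  assumes "\<And>k. transpose (B k) = - B k"
  shows "disp B x (shift B \<eta> x - \<eta>) = \<eta>"
  using skew_inner_self[OF assms] skew_inner[OF assms, of _ "hpart \<eta>" "hpart x"]
  by (simp add: vec_sum_eq_iff shift_nth disp_nth gauge_lin_def inner_diff_left matrix_vector_mult_diff_distrib)

text \<open>Inversion in the group is negation, and the gauge is even. The penalty can therefore be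
  differentiated in \<open>y\<close> with the formulas for \<open>gauge B x\<close>.\<close>

lemma gauge_sym:
  assumes "\<And>k. transpose (B k) = - B k"
  shows "gauge B y x = gauge B x y"
proof -
  have "disp B x y $ Inr k = - (disp B y x $ Inr k)" for k
    using skew_inner[OF assms, of k "hpart y" "hpart x"] by (simp add: disp_nth gauge_lin_def)
  moreover have "(hpart x - hpart y) \<bullet> (hpart x - hpart y) = (hpart y - hpart x) \<bullet> (hpart y - hpart x)"
    by (simp add: inner_diff algebra_simps)
  ultimately show ?thesis by (simp add: gauge_def)
qed

lemma gauge_nonneg: "0 \<le> gauge B y x"
  by (simp add: gauge_def sum_nonneg)

text \<open>The horizontal parts agree first; the cross term in the vertical coordinates is then
  \<open>(B k *v a) \<bullet> a\<close>, which is zero by skewness.\<close>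

lemma gauge_eq_0D:
  assumes skew: "\<And>k. transpose (B k) = - B k" and "gauge B y x = 0"
  shows "x = y"
proof -
  let ?s = "\<Sum>k\<in>UNIV. (disp B x y $ Inr k)\<^sup>2"
  have s: "0 \<le> ?s" by (simp add: sum_nonneg)
  have "(hpart (disp B x y) \<bullet> hpart (disp B x y))\<^sup>2 = 0 \<and> ?s = 0"
    using assms(2) s unfolding gauge_def by (smt (verit) zero_le_power2)
  then have h: "hpart x = hpart y" and k: "\<And>k. disp B x y $ Inr k = 0"
    by (auto simp: sum_nonneg_eq_0_iff)
  show ?thesis
  proof (unfold vec_sum_eq_iff, intro conjI allI)
    show "x $ Inl i = y $ Inl i" for i using arg_cong[OF h, of "\<lambda>v. v $ i"] by simp
    show "x $ Inr k' = y $ Inr k'" for k'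
      using k[of k'] by (simp add: disp_nth gauge_lin_def h skew_inner_self[OF skew])
  qed
qed

lemma continuous_on_hpart [continuous_intros]:
  "continuous_on S f \<Longrightarrow> continuous_on S (\<lambda>x. hpart (f x))"
  unfolding hpart_def by (intro continuous_intros)

lemma continuous_on_matrix_vector [continuous_intros]:
  fixes A :: "real^'n^'m"
  shows "continuous_on S f \<Longrightarrow> continuous_on S (\<lambda>x. A *v f x)"
  by (rule bounded_linear.continuous_on[OF matrix_vector_mul_bounded_linear])

lemma continuous_on_disp [continuous_intros]:
  assumes "continuous_on S f" "continuous_on S g"
  shows "continuous_on S (\<lambda>x. disp B (f x) (g x))"
proof -
  have "continuous_on S (\<lambda>x. disp B (f x) (g x) $ r)" for r
    using assms by (cases r) (auto simp: disp_def gauge_lin_def intro!: continuous_intros)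
  then have "continuous_on S (\<lambda>x. \<chi> r. disp B (f x) (g x) $ r)" by (rule continuous_on_vec_lambda)
  then show ?thesis by simp
qed

lemma continuous_on_shift [continuous_intros]:
  assumes "continuous_on S f" "continuous_on S g"
  shows "continuous_on S (\<lambda>x. shift B (f x) (g x))"
proof -
  have "continuous_on S (\<lambda>x. shift B (f x) (g x) $ r)" for r
    using assms by (cases r) (auto simp: shift_def intro!: continuous_intros)
  then have "continuous_on S (\<lambda>x. \<chi> r. shift B (f x) (g x) $ r)" by (rule continuous_on_vec_lambda)
  then show ?thesis by simp
qed

lemma continuous_on_gauge [continuous_intros]:
  assumes "continuous_on S f" "continuous_on S g"
  shows "continuous_on S (\<lambda>x. gauge B (f x) (g x))"
  unfolding gauge_def by (intro continuous_intros assms)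

lemma linear_shift: "linear (shift B \<eta>)"
  by (rule linearI) (simp_all add: vec_sum_eq_iff shift_def matrix_vector_right_distrib inner_add_left
      matrix_vector_mult_scaleR algebra_simps)

lemma linear_gauge_lin: "linear (gauge_lin B y k)"
  by (rule linearI) (simp_all add: gauge_lin_def inner_add_right algebra_simps)

lemma linear_hpart: "linear hpart"
  by (rule linearI) simp_all

section \<open>Derivatives of the gauge\<close>

definition dgauge where
  "dgauge B y x h = 2 * ((hpart x - hpart y) \<bullet> (hpart x - hpart y)) * (2 * ((hpart x - hpart y) \<bullet> hpart h))
     + (\<Sum>k\<in>UNIV. 2 * ((gauge_lin B y k x - y $ Inr k) * gauge_lin B y k h))"

definition d2gauge where
  "d2gauge B y x h k = 2 * (2 * ((hpart x - hpart y) \<bullet> hpart h)) * (2 * ((hpart x - hpart y) \<bullet> hpart k))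
     + 2 * ((hpart x - hpart y) \<bullet> (hpart x - hpart y)) * (2 * (hpart h \<bullet> hpart k))
     + (\<Sum>j\<in>UNIV. 2 * (gauge_lin B y j h * gauge_lin B y j k))"

lemma jet_gauge:
  fixes B :: "'k::finite \<Rightarrow> real^'m::finite^'m"
  shows "has_jet S (\<lambda>z :: (real^('m + 'k)) \<times> real. gauge B y (fst z))
    (\<lambda>z h. dgauge B y (fst z) (fst h)) (\<lambda>z h k. d2gauge B y (fst z) (fst h) (fst k))"
proof -
  have lh: "linear (\<lambda>z :: (real^('m + 'k)) \<times> real. hpart (fst z))"
    using linear_compose[OF linear_fst linear_hpart] by (simp add: o_def)
  have lg: "linear (\<lambda>z :: (real^('m + 'k)) \<times> real. gauge_lin B y k (fst z))" for k
    using linear_compose[OF linear_fst linear_gauge_lin] by (simp add: o_def)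
  have sq: "has_jet S (\<lambda>z :: (real^('m + 'k)) \<times> real.
        (gauge_lin B y k (fst z) - y $ Inr k) \<bullet> (gauge_lin B y k (fst z) - y $ Inr k))
      (\<lambda>z h. 2 * ((gauge_lin B y k (fst z) - y $ Inr k) \<bullet> gauge_lin B y k (fst h)))
      (\<lambda>z h j. 2 * (gauge_lin B y k (fst h) \<bullet> gauge_lin B y k (fst j)))" for k
    by (rule jet_inner_self[OF lg])
  from jet_add[OF jet_power2[OF jet_inner_self[OF lh, of S "hpart y"]]
      jet_sum[OF finite_class.finite_UNIV sq]]
  show ?thesis
    by (simp add: gauge_def dgauge_def d2gauge_def disp_nth power2_eq_square)
qed

lemma gauge_lin_sigma: "gauge_lin B y k (sigma B x *v v) = (B k *v (hpart x - hpart y)) \<bullet> v"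
  by (simp add: gauge_lin_def sigma_mult_nth matrix_vector_mult_diff_distrib inner_diff_left)

text \<open>The fourth power has zero second derivative where the horizontal parts agree, which is
  the reason for the exponent. By \<open>gauge_lin_sigma\<close>, horizontal directions there do not
  change the vertical coordinates of the displacement to first order.\<close>

lemma gauge_derivs_sigma:
  assumes "hpart x = hpart y"
  shows "dgauge B y x (sigma B x *v v) = 0"
    and "d2gauge B y x (sigma B x *v v) (sigma B x *v w) = 0"
  by (simp_all add: dgauge_def d2gauge_def gauge_lin_sigma assms)

text \<open>Since \<open>gauge\<close> is constant along the right translation by \<open>\<eta>\<inverse>\<close>, this is minus the horizontal
  derivative of \<open>gauge B y\<close> at \<open>x\<close> in the direction of \<open>\<eta>\<^sub>h\<close>.\<close>

lemma dgauge_shift_sigma: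
  assumes "\<And>k. transpose (B k) = - B k"
  shows "dgauge B x y (shift B (disp B x y) (sigma B x *v (hpart x - hpart y)))
    = - 4 * ((hpart x - hpart y) \<bullet> (hpart x - hpart y))\<^sup>2"
proof -
  let ?\<xi> = "hpart x - hpart y"
  \<comment> \<open>The vertical squares drop out in this direction: the shift subtracts a term of
    the form \<open>(B k *v a) \<bullet> a\<close>, which is zero, and \<open>gauge_lin\<close>
    removes the vertical part supplied by \<open>sigma\<close>.\<close>
  have "gauge_lin B x k (shift B (disp B x y) (sigma B x *v ?\<xi>)) = 0" for k
    by (simp add: gauge_lin_def shift_nth sigma_mult_nth skew_inner_self[OF assms])
  moreover have "(hpart y - hpart x) \<bullet> ?\<xi> = - (?\<xi> \<bullet> ?\<xi>)"
    "(hpart y - hpart x) \<bullet> (hpart y - hpart x) = ?\<xi> \<bullet> ?\<xi>"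
    by (simp_all add: inner_diff inner_commute algebra_simps)
  ultimately show ?thesis
    by (simp add: dgauge_def power2_eq_square)
qed

section \<open>Doubling of variables\<close>

text \<open>Space is doubled and time is shared. The aim is a single penalty size whose maximizer
  over a compact box lies within \<open>\<rho>\<close> of the centre, hence in the interior for
  small \<open>\<rho>\<close>, where optimality conditions apply.\<close>

lemma penalized_maximizer:
  fixes u \<phi> :: "'a::euclidean_space \<times> real \<Rightarrow> real" and \<psi> :: "'a \<times> 'a \<Rightarrow> real"
  assumes u: "usc_on S u" and \<phi>: "continuous_on S \<phi>" and \<psi>: "continuous_on UNIV \<psi>"
    and \<psi>pos: "\<And>x y. 0 \<le> \<psi> (x, y)" "\<And>x y. \<psi> (x, y) = 0 \<longleftrightarrow> x = y"
    and box: "cball x0 R \<times> cball t0 R \<subseteq> S" and R: "0 < R" and \<rho>: "0 < \<rho>"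
    and strict: "\<And>x t. dist x0 x \<le> R \<Longrightarrow> dist t0 t \<le> R \<Longrightarrow> (x, t) \<noteq> (x0, t0) \<Longrightarrow>
        u (x, t) - \<phi> (x, t) < u (x0, t0) - \<phi> (x0, t0)"
  obtains N x y t where "N > (0::real)" "dist x0 x < \<rho>" "dist x0 y < \<rho>" "dist t0 t < \<rho>"
    and "\<And>x' y' t'. dist x0 x' \<le> R \<Longrightarrow> dist x0 y' \<le> R \<Longrightarrow> dist t0 t' \<le> R \<Longrightarrow>
      u (x', t') - \<phi> (y', t') - N * \<psi> (x', y') \<le> u (x, t) - \<phi> (y, t) - N * \<psi> (x, y)"
proof -
  define K where "K = cball x0 R \<times> cball x0 R \<times> cball t0 R"
  define K' where "K' = K - ball x0 \<rho> \<times> ball x0 \<rho> \<times> ball t0 \<rho>"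
  define f where "f n z = u (fst z, snd (snd z)) -
      (\<phi> (fst (snd z), snd (snd z)) + real (Suc n) * \<psi> (fst z, fst (snd z)))" for n z
  have K: "compact K" unfolding K_def by (intro compact_Times compact_cball)
  have K': "compact K'" "K' \<subseteq> K" unfolding K'_def
    by (auto intro!: compact_diff K open_Times)
  have usc: "usc_on K (f n)" for n
    unfolding f_def
  proof (rule usc_on_compose_diff[OF u, where p = "\<lambda>z. (fst z, snd (snd z))"])
    show "(\<lambda>z. (fst z, snd (snd z))) ` K \<subseteq> S" using box by (auto simp: K_def)
    have "continuous_on K (\<lambda>z. \<phi> (fst (snd z), snd (snd z)))"
      by (rule continuous_on_compose2[OF \<phi>]) (use box in \<open>auto simp: K_def intro!: continuous_intros\<close>)
    moreover have "continuous_on K (\<lambda>z. \<psi> (fst z, fst (snd z)))"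
      by (rule continuous_on_compose2[OF \<psi>]) (auto intro!: continuous_intros)
    ultimately show "continuous_on K (\<lambda>z. \<phi> (fst (snd z), snd (snd z)) + real (Suc n) * \<psi> (fst z, fst (snd z)))"
      by (intro continuous_intros)
  qed (intro continuous_intros)
  have usc': "usc_on K' (f n)" for n
    using usc[of n] K'(2) unfolding usc_on_metric by blast
  let ?c = "u (x0, t0) - \<phi> (x0, t0)"
  \<comment> \<open>By Dini, a large penalty makes \<open>f n\<close> smaller than its value at the centre away from the centre.\<close>
  have "\<exists>n. \<forall>z\<in>K'. f n z < ?c"
  proof (rule usc_on_dini[OF K'(1) usc'])
    fix m n :: nat and z assume "m \<le> n" "z \<in> K'"
    then show "f n z \<le> f m z"
      using \<psi>pos(1) unfolding f_def by (intro diff_left_mono add_left_mono mult_right_mono) auto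
  next
    fix z assume z: "z \<in> K'"
    obtain x y t where xyt: "z = (x, y, t)" by (metis prod.exhaust)
    show "\<exists>n. f n z < ?c"
    proof (cases "x = y")
      case True
      \<comment> \<open>On the diagonal the penalty vanishes and strictness gives the bound; off the
        diagonal the penalty is positive and wins for large \<open>n\<close>.\<close>
      have "(x, t) \<noteq> (x0, t0)" using z True \<rho> by (auto simp: xyt K'_def)
      moreover have "dist x0 x \<le> R" "dist t0 t \<le> R" using z by (auto simp: xyt K'_def K_def)
      ultimately have "u (x, t) - \<phi> (x, t) < ?c" by (intro strict)
      moreover have "\<psi> (x, x) = 0" using \<psi>pos(2) by blast
      ultimately show ?thesis using True by (intro exI[of _ 0]) (simp add: f_def xyt)
    next
      case False
      then have pos: "0 < \<psi> (x, y)" using \<psi>pos by (metis less_eq_real_def)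
      obtain n where n: "u (x, t) - \<phi> (y, t) - ?c < real n * \<psi> (x, y)"
        using reals_Archimedean3[OF pos] by blast
      also have "real n * \<psi> (x, y) \<le> real (Suc n) * \<psi> (x, y)" using pos by simp
      finally show ?thesis by (intro exI[of _ n]) (simp add: f_def xyt algebra_simps)
    qed
  qed
  then obtain n where n: "\<And>z. z \<in> K' \<Longrightarrow> f n z < ?c" by blast
  have z0: "(x0, x0, t0) \<in> K" using R by (simp add: K_def)
  then have "K \<noteq> {}" by blast
  then obtain z where z: "z \<in> K" "\<forall>w\<in>K. f n w \<le> f n z"
    using usc_on_attains_max[OF K _ usc[of n]] by blast
  have "\<psi> (x0, x0) = 0" using \<psi>pos(2) by blast
  then have "?c = f n (x0, x0, t0)" by (simp add: f_def)
  also have "\<dots> \<le> f n z" using z z0 by blast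
  finally have "z \<notin> K'" using n by (meson not_less)
  then have near: "z \<in> ball x0 \<rho> \<times> ball x0 \<rho> \<times> ball t0 \<rho>" using z(1) by (simp add: K'_def)
  show ?thesis
  proof (rule that[of "real (Suc n)" "fst z" "fst (snd z)" "snd (snd z)"])
    fix x' y' t' assume "dist x0 x' \<le> R" "dist x0 y' \<le> R" "dist t0 t' \<le> R"
    then have "(x', y', t') \<in> K" by (simp add: K_def)
    with z(2) have "f n (x', y', t') \<le> f n z" by blast
    then show "u (x', t') - \<phi> (y', t') - real (Suc n) * \<psi> (x', y')
      \<le> u (fst z, snd (snd z)) - \<phi> (fst (snd z), snd (snd z)) - real (Suc n) * \<psi> (fst z, fst (snd z))"
      by (simp add: f_def)
  qed (use near in \<open>auto simp: mem_Times_iff\<close>)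
qed

text \<open>The pointwise conditions of the theorem for subsolutions, named so that they can also be
  used for \<open>dual_op F\<close>.\<close>

definition sub_test :: "('m::finite, 'k::finite) Fop \<Rightarrow> ('k \<Rightarrow> real^'m^'m) \<Rightarrow>
    ((real^('m+'k)) \<times> real \<Rightarrow> real) \<Rightarrow> bool" where
  "sub_test F B u \<longleftrightarrow>
     (\<forall>\<phi>. C2_on Omega \<phi> \<longrightarrow> (\<forall>x t. 0 < t \<and> local_max_at Omega (\<lambda>z. u z - \<phi> z) (x, t) \<longrightarrow>
        (Xgrad B \<phi> (x, t) \<noteq> 0 \<longrightarrow>
           dtime \<phi> (x, t) + F x t (Xgrad B \<phi> (x, t)) (Xhess B \<phi> (x, t)) \<le> 0)
      \<and> (Xgrad B \<phi> (x, t) = 0 \<and> Xhess B \<phi> (x, t) = 0 \<longrightarrow> dtime \<phi> (x, t) \<le> 0)))"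

lemma continuous_on_derivs:
  assumes j: "has_jet Omega \<phi> d d2"
  shows "continuous_on Omega (dtime \<phi>)" "continuous_on Omega (grad \<phi>)" "continuous_on Omega (hess \<phi>)"
proof -
  have "continuous_on Omega (\<lambda>z. d z (0, 1))"
    "continuous_on Omega (\<lambda>z. \<chi> i. d z (axis i 1, 0))"
    "continuous_on Omega (\<lambda>z. \<chi> i j. d2 z (axis i 1, 0) (axis j 1, 0))"
    by (intro continuous_intros has_jet_continuous_on(2)[OF j] has_jetD(3)[OF j])+
  then show "continuous_on Omega (dtime \<phi>)" "continuous_on Omega (grad \<phi>)" "continuous_on Omega (hess \<phi>)"
    using jet_derivs[OF j open_Omega] by (simp_all cong: continuous_on_cong)
qed

text \<open>The vector and matrix in the estimate are the gradient and Hessian, at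
  \<open>(x, t)\<close>, of the right translate of \<open>\<phi>\<close> that carries
  \<open>x\<close> to \<open>y\<close>. At \<open>x = y\<close> the translation is the identity, so
  joint continuity gives the bound, and the choice \<open>x = y\<close> recovers the derivatives of
  \<open>\<phi>\<close> itself.\<close>

lemma derivs_near:
  fixes B :: "'k::finite \<Rightarrow> real^'m::finite^'m"
  assumes j: "has_jet Omega \<phi> d d2" and skew: "\<And>k. transpose (B k) = - B k"
    and t0: "0 < t0" and r: "0 < r" and \<delta>: "0 < \<delta>"
  obtains \<rho> where "0 < \<rho>" "\<rho> < t0"
    and "\<And>x y t. dist x0 x < \<rho> \<Longrightarrow> dist x0 y < \<rho> \<Longrightarrow> dist t0 t < \<rho> \<Longrightarrow>
      norm (x0 - x, t0 - t,
        grad \<phi> (x0, t0) - (\<chi> i. grad \<phi> (y, t) \<bullet> shift B (disp B x y) (axis i 1)),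
        hess \<phi> (x0, t0) - (\<chi> i j. shift B (disp B x y) (axis i 1) \<bullet>
          (hess \<phi> (y, t) *v shift B (disp B x y) (axis j 1)))) < r"
    and "\<And>y t. dist x0 y < \<rho> \<Longrightarrow> dist t0 t < \<rho> \<Longrightarrow> \<bar>dtime \<phi> (x0, t0) - dtime \<phi> (y, t)\<bar> < \<delta>"
proof -
  define D where "D = (UNIV :: (real^('m + 'k)) set) \<times> (UNIV :: (real^('m + 'k)) set) \<times> {0 :: real <..}"
  define \<Theta> where "\<Theta> w = (fst w, snd (snd w),
      (\<chi> i. grad \<phi> (snd w) \<bullet> shift B (disp B (fst w) (fst (snd w))) (axis i 1)),
      (\<chi> i j. shift B (disp B (fst w) (fst (snd w))) (axis i 1) \<bullet>
          (hess \<phi> (snd w) *v shift B (disp B (fst w) (fst (snd w))) (axis j 1))))"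
    for w :: "(real^('m + 'k)) \<times> (real^('m + 'k)) \<times> real"
  note cont = continuous_on_derivs[OF j]
  have D: "snd ` D \<subseteq> Omega" by (auto simp: D_def)
  have 1: "continuous_on D (\<lambda>w. grad \<phi> (snd w))"
    by (rule continuous_on_compose2[OF cont(2) _ D]) (intro continuous_intros)
  have 2: "continuous_on D (\<lambda>w. hess \<phi> (snd w))"
    by (rule continuous_on_compose2[OF cont(3) _ D]) (intro continuous_intros)
  have 3: "continuous_on D \<Theta>"
    unfolding \<Theta>_def matrix_vector_mult_def inner_vec_def
    by (simp, intro continuous_intros 1 2)
  have at: "(x0, x0, t0) \<in> D" using t0 by (simp add: D_def)
  obtain e1 where e1: "e1 > 0" "\<And>w. w \<in> D \<Longrightarrow> dist w (x0, x0, t0) < e1 \<Longrightarrow> dist (\<Theta> w) (\<Theta> (x0, x0, t0)) < r"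
    using 3 at r unfolding continuous_on_iff by meson
  have "(x0, t0) \<in> Omega" using t0 by simp
  then obtain e2 where e2: "e2 > 0"
    "\<And>w. w \<in> Omega \<Longrightarrow> dist w (x0, t0) < e2 \<Longrightarrow> dist (dtime \<phi> w) (dtime \<phi> (x0, t0)) < \<delta>"
    using cont(1) \<delta> unfolding continuous_on_iff by meson
  \<comment> \<open>Three coordinates, each moved by less than \<open>\<rho>\<close>, add up to less
    than \<open>3 * \<rho>\<close>; the bound \<open>t0/2\<close> keeps time positive.\<close>
  define \<rho> where "\<rho> = min (t0/2) (min (e1/3) (e2/3))"
  have \<rho>: "0 < \<rho>" "\<rho> < t0" "3 * \<rho> \<le> e1" "3 * \<rho> \<le> e2" using t0 e1(1) e2(1) by (auto simp: \<rho>_def)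
  have d2le: "dist (a, b) (a', b') \<le> dist a a' + dist b b'"
    for a a' :: "'z::metric_space" and b b' :: "'w::metric_space"
    by (simp add: dist_Pair_Pair sqrt_sum_squares_le_sum)
  have \<Theta>0: "\<Theta> (x0, x0, t0) = (x0, t0, grad \<phi> (x0, t0), hess \<phi> (x0, t0))"
    by (simp add: \<Theta>_def disp_self[OF skew] vec_eq_iff inner_axis inner_axis' matrix_vector_mul_component)
  show ?thesis
  proof (rule that[OF \<rho>(1,2)])
    fix x y t assume *: "dist x0 x < \<rho>" "dist x0 y < \<rho>" "dist t0 t < \<rho>"
    have "dist (x, y, t) (x0, x0, t0) < e1"
      using d2le[of x "(y, t)" x0 "(x0, t0)"] d2le[of y t x0 t0] * \<rho> by (simp add: dist_commute)
    moreover have "(x, y, t) \<in> D" using *(3) \<rho>(2) by (simp add: D_def dist_real_def)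
    ultimately have "dist (\<Theta> (x0, x0, t0)) (\<Theta> (x, y, t)) < r"
      using e1(2)[of "(x, y, t)"] by (simp add: dist_commute)
    then show "norm (x0 - x, t0 - t,
        grad \<phi> (x0, t0) - (\<chi> i. grad \<phi> (y, t) \<bullet> shift B (disp B x y) (axis i 1)),
        hess \<phi> (x0, t0) - (\<chi> i j. shift B (disp B x y) (axis i 1) \<bullet>
          (hess \<phi> (y, t) *v shift B (disp B x y) (axis j 1)))) < r"
      unfolding \<Theta>0 by (simp add: \<Theta>_def dist_norm)
  next
    fix y t assume *: "dist x0 y < \<rho>" "dist t0 t < \<rho>"
    have "dist (y, t) (x0, t0) < e2"
      using d2le[of y t x0 t0] * \<rho> by (simp add: dist_commute)
    moreover have "(y, t) \<in> Omega" using *(2) \<rho>(2) by (simp add: dist_real_def)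
    ultimately show "\<bar>dtime \<phi> (x0, t0) - dtime \<phi> (y, t)\<bar> < \<delta>"
      using e2(2)[of "(y, t)"] by (simp add: dist_real_def abs_minus_commute)
  qed
qed

text \<open>The conclusion asks for one nearby value of \<open>G\<close> per radius and tolerance,
  which is what the criterion for an upper bound on \<open>G_lower\<close> in
  \<open>G_lower_limit\<close> requires. Strictness localizes the doubled maximizer.\<close>

lemma doubling_strict:
  fixes F :: "('m::finite, 'k::finite) Fop" and B :: "'k \<Rightarrow> real^'m^'m"
  assumes skew: "\<And>k. transpose (B k) = - B k" and F2: "F2 F" and F3: "F3 F"
    and u: "usc_on Omega u" and test: "sub_test F B u"
    and j: "has_jet Omega \<phi> d d2" and t0: "0 < t0" and R0: "0 < R0"
    and strict: "\<And>x t. 0 < t \<Longrightarrow> dist (x, t) (x0, t0) < R0 \<Longrightarrow> (x, t) \<noteq> (x0, t0) \<Longrightarrow>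
        u (x, t) - \<phi> (x, t) < u (x0, t0) - \<phi> (x0, t0)"
    and r: "0 < r" and \<delta>: "0 < \<delta>"
  shows "\<exists>g\<in>G_values F B x0 t0 (grad \<phi> (x0, t0)) (hess \<phi> (x0, t0)) r. dtime \<phi> (x0, t0) + g < \<delta>"
proof -
  \<comment> \<open>Points of the box are within \<open>2 * R\<close> of the centre, hence inside
    the region of strictness, and \<open>R < t0\<close> keeps the box in
    \<open>Omega\<close>.\<close>
  define R where "R = min (R0/3) (t0/2)"
  have R: "0 < R" "2 * R < R0" "R < t0" using R0 t0 by (auto simp: R_def)
  obtain \<rho>' where \<rho>': "0 < \<rho>'" "\<rho>' < t0"
    and near: "\<And>x y t. dist x0 x < \<rho>' \<Longrightarrow> dist x0 y < \<rho>' \<Longrightarrow> dist t0 t < \<rho>' \<Longrightarrow>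
      norm (x0 - x, t0 - t,
        grad \<phi> (x0, t0) - (\<chi> i. grad \<phi> (y, t) \<bullet> shift B (disp B x y) (axis i 1)),
        hess \<phi> (x0, t0) - (\<chi> i j. shift B (disp B x y) (axis i 1) \<bullet>
          (hess \<phi> (y, t) *v shift B (disp B x y) (axis j 1)))) < r/2"
    and near': "\<And>y t. dist x0 y < \<rho>' \<Longrightarrow> dist t0 t < \<rho>' \<Longrightarrow> \<bar>dtime \<phi> (x0, t0) - dtime \<phi> (y, t)\<bar> < \<delta>/2"
    by (rule derivs_near[OF j skew t0 half_gt_zero[OF r] half_gt_zero[OF \<delta>]], rule that)
  define \<rho> where "\<rho> = min R \<rho>'"
  have \<rho>: "0 < \<rho>" "\<rho> \<le> R" "\<rho> \<le> \<rho>'" using R \<rho>' by (auto simp: \<rho>_def)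
  have box: "cball x0 R \<times> cball t0 R \<subseteq> Omega"
    using R by (auto simp: dist_real_def)
  have strict': "u (x, t) - \<phi> (x, t) < u (x0, t0) - \<phi> (x0, t0)"
    if "dist x0 x \<le> R" "dist t0 t \<le> R" "(x, t) \<noteq> (x0, t0)" for x t
  proof (rule strict)
    have "dist (x, t) (x0, t0) \<le> dist x x0 + dist t t0"
      by (simp add: dist_Pair_Pair sqrt_sum_squares_le_sum)
    with that R show "dist (x, t) (x0, t0) < R0" by (simp add: dist_commute)
    show "0 < t" using that R by (simp add: dist_real_def)
  qed fact
  have gc: "continuous_on UNIV (\<lambda>(x, y). gauge B y x)"
    unfolding case_prod_unfold by (intro continuous_intros)
  have g0: "gauge B y x = 0 \<longleftrightarrow> x = y" for x y
    using gauge_eq_0D[OF skew, where x = x and y = y] by (auto simp: gauge_def disp_self[OF skew])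
  obtain N x y t where N: "N > 0" and xyt: "dist x0 x < \<rho>" "dist x0 y < \<rho>" "dist t0 t < \<rho>"
    and mx: "\<And>x' y' t'. dist x0 x' \<le> R \<Longrightarrow> dist x0 y' \<le> R \<Longrightarrow> dist t0 t' \<le> R \<Longrightarrow>
      u (x', t') - \<phi> (y', t') - N * gauge B y' x' \<le> u (x, t) - \<phi> (y, t) - N * gauge B y x"
    by (rule penalized_maximizer[OF u has_jet_continuous_on(1)[OF j] gc _ _ box R(1) \<rho>(1) strict',
          unfolded split_conv, OF gauge_nonneg g0], assumption+, rule that)
  have t: "0 < t" using xyt(3) \<rho> R by (simp add: dist_real_def)
  then have zO: "(y, t) \<in> Omega" "(x, t) \<in> Omega" by simp_all
  have dt: "\<bar>dtime \<phi> (x0, t0) - dtime \<phi> (y, t)\<bar> < \<delta>/2" using xyt \<rho> by (intro near') auto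
  have dty: "dtime \<phi> (y, t) = d (y, t) (0, 1)" by (rule jet_derivs(1)[OF j open_Omega zO(1)])
  let ?\<xi> = "hpart x - hpart y"
  have tball: "dist t0 t' \<le> R" if "dist t' t < \<rho> - dist t0 t" for t'
    using dist_triangle[of t0 t' t] that \<rho>(2) by (simp add: dist_commute)
  have xball: "dist x0 x' \<le> R" if "dist x' x < \<rho> - dist x0 x" for x'
    using dist_triangle[of x0 x' x] that \<rho>(2) by (simp add: dist_commute)
  have yball: "dist x0 y' \<le> R" if "dist y' y < \<rho> - dist x0 y" for y'
    using dist_triangle[of x0 y' y] that \<rho>(2) by (simp add: dist_commute)
  \<comment> \<open>With \<open>x\<close> and \<open>t\<close> fixed, \<open>y\<close> is a local
    minimizer of \<open>\<phi> (y, t) + N * gauge B x y\<close>; these are the first and second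
    order conditions in spatial directions.\<close>
  have ymin: "d (y, t) (h, 0) + N * dgauge B x y h = 0"
    "0 \<le> d2 (y, t) (h, 0) (h, 0) + N * d2gauge B x y h h" for h
  proof -
    note jf = jet_add[OF j jet_cmult[OF jet_gauge[of Omega B x], of N]]
    have pos: "norm h + 1 > 0" by (simp add: add_nonneg_pos)
    let ?e = "(\<rho> - dist x0 y) / (norm h + 1)"
    have e: "0 < ?e" using xyt pos by simp
    have mn: "\<phi> (y, t) + N * gauge B x (fst (y, t)) \<le>
        \<phi> ((y, t) + s *\<^sub>R (h, 0)) + N * gauge B x (fst ((y, t) + s *\<^sub>R (h, 0)))" if "\<bar>s\<bar> < ?e" for s
    proof -
      have "\<bar>s\<bar> * norm h \<le> \<bar>s\<bar> * (norm h + 1)" by (intro mult_left_mono) auto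
      also have "\<dots> < \<rho> - dist x0 y" using that pos by (simp add: pos_less_divide_eq)
      finally have "dist x0 (y + s *\<^sub>R h) \<le> R" by (intro yball) (simp add: dist_norm)
      from mx[OF _ this, of x t] xyt \<rho> show ?thesis
        by (simp add: gauge_sym[OF skew, where y = x])
    qed
    from jet_min_along_line[OF jf open_Omega zO(1) e mn]
    show "d (y, t) (h, 0) + N * dgauge B x y h = 0"
      "0 \<le> d2 (y, t) (h, 0) (h, 0) + N * d2gauge B x y h h" by simp_all
  qed
  show ?thesis
  proof (cases "?\<xi> = 0")
    case False
    \<comment> \<open>Freezing \<open>\<eta>\<close> and moving \<open>y\<close> along with
      \<open>x\<close> keeps the penalty constant, so \<open>\<phi>2\<close> alone serves as a test
      function for \<open>u\<close> at \<open>(x, t)\<close>.\<close>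
    define \<eta> where "\<eta> = disp B x y"
    define A where "A z = (shift B \<eta> (fst z), snd z)" for z :: "(real^('m+'k)) \<times> real"
    define \<phi>2 where "\<phi>2 z = \<phi> (A z + (- \<eta>, 0))" for z
    have linA: "linear A"
      by (rule linearI) (simp_all add: A_def linear_add[OF linear_shift] linear_scale[OF linear_shift])
    have j2: "has_jet Omega \<phi>2 (\<lambda>z h. d (A z + (- \<eta>, 0)) (A h)) (\<lambda>z h k. d2 (A z + (- \<eta>, 0)) (A h) (A k))"
      unfolding \<phi>2_def by (rule jet_compose_affine[OF j linA]) (auto simp: A_def Omega_def)
    have Ay: "A (x, t) + (- \<eta>, 0) = (y, t)"
      using shift_disp[OF skew, where x = x and y = y] by (simp add: A_def \<eta>_def)
    have sh0: "shift B \<eta> 0 = 0" by (rule linear_0[OF linear_shift])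
    have dt2: "dtime \<phi>2 (x, t) = dtime \<phi> (y, t)"
      using jet_derivs(1)[OF j2 open_Omega zO(2)] Ay dty by (simp add: A_def sh0)
    have gr2: "grad \<phi>2 (x, t) = (\<chi> i. grad \<phi> (y, t) \<bullet> shift B \<eta> (axis i 1))"
      using jet_derivs(2)[OF j2 open_Omega zO(2)] Ay grad_inner[OF j zO(1)] by (simp add: A_def)
    have he2: "hess \<phi>2 (x, t) = (\<chi> i j. shift B \<eta> (axis i 1) \<bullet> (hess \<phi> (y, t) *v shift B \<eta> (axis j 1)))"
      using jet_derivs(3)[OF j2 open_Omega zO(2)] Ay hess_inner[OF j zO(1)] by (simp add: A_def)
    \<comment> \<open>Pairing with the horizontal displacement detects that the gradient is nonzero:
      by optimality in \<open>y\<close> the result is \<open>4 * N\<close> times the fourth power of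
      the length of that displacement.\<close>
    have "Xgrad B \<phi>2 (x, t) \<bullet> ?\<xi> = d (y, t) (shift B \<eta> (sigma B x *v ?\<xi>), 0)"
      using Xgrad_inner[OF j2 zO(2), of B ?\<xi>] Ay by (simp add: A_def)
    also have "\<dots> = 4 * N * (?\<xi> \<bullet> ?\<xi>)\<^sup>2"
      using ymin(1)[of "shift B \<eta> (sigma B x *v ?\<xi>)"] dgauge_shift_sigma[OF skew, where x = x and y = y]
      by (simp add: \<eta>_def)
    finally have X: "Xgrad B \<phi>2 (x, t) \<noteq> 0" using False N by (auto simp del: inner_diff_right)
    have C2: "C2_on Omega \<phi>2" using j2 C2_on_iff_jet by blast
    have lm: "local_max_at Omega (\<lambda>z. u z - \<phi>2 z) (x, t)"
    proof -
      have "continuous_on UNIV (\<lambda>x'. shift B \<eta> x' - \<eta>)" by (intro continuous_intros)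
      then have "isCont (\<lambda>x'. shift B \<eta> x' - \<eta>) x" by (simp add: continuous_on_eq_continuous_at)
      moreover have "shift B \<eta> x - \<eta> = y" using shift_disp[OF skew] by (simp add: \<eta>_def)
      ultimately obtain e where e: "e > 0"
        "\<And>x'. dist x' x < e \<Longrightarrow> dist (shift B \<eta> x' - \<eta>) y < \<rho> - dist x0 y"
        using xyt(2) unfolding continuous_at_eps_delta by (metis diff_gt_0_iff_gt)
      define r' where "r' = min e (min (\<rho> - dist x0 x) (\<rho> - dist t0 t))"
      have r': "0 < r'" using e xyt by (simp add: r'_def)
      have "u (x', t') - \<phi>2 (x', t') \<le> u (x, t) - \<phi>2 (x, t)" if "dist (x', t') (x, t) < r'" for x' t'
      proof -
        have "dist x' x < r'" "dist t' t < r'"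
          using that dist_fst_le[of "(x', t')" "(x, t)"] dist_snd_le[of "(x', t')" "(x, t)"] by simp_all
        then have "dist x0 x' \<le> R" "dist x0 (shift B \<eta> x' - \<eta>) \<le> R" "dist t0 t' \<le> R"
          by (auto simp: r'_def intro: xball yball tball e(2))
        from mx[OF this] have "u (x', t') - \<phi> (shift B \<eta> x' - \<eta>, t') \<le> u (x, t) - \<phi> (y, t)"
          by (simp add: gauge_def disp_shift[OF skew] \<eta>_def)
        then show ?thesis unfolding \<phi>2_def Ay by (simp add: A_def)
      qed
      then show ?thesis using r' unfolding local_max_at_def by auto
    qed
    have le: "dtime \<phi>2 (x, t) + F x t (Xgrad B \<phi>2 (x, t)) (Xhess B \<phi>2 (x, t)) \<le> 0"
      using test C2 lm t X unfolding sub_test_def by blast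
    let ?g = "Gop F B x t (grad \<phi>2 (x, t)) (hess \<phi>2 (x, t))"
    have "norm (x0 - x, t0 - t, grad \<phi> (x0, t0) - grad \<phi>2 (x, t), hess \<phi> (x0, t0) - hess \<phi>2 (x, t)) < r/2"
      unfolding gr2 he2 \<eta>_def using xyt \<rho> by (intro near) auto
    then have "?g \<in> G_values F B x0 t0 (grad \<phi> (x0, t0)) (hess \<phi> (x0, t0)) r"
      using X t symm_hess[OF j2 zO(2)] r unfolding G_values_def Xgrad_def
      by (intro CollectI exI[of _ x] exI[of _ t] exI[of _ "grad \<phi>2 (x, t)"] exI[of _ "hess \<phi>2 (x, t)"]) auto
    moreover have "dtime \<phi> (x0, t0) + ?g < \<delta>"
      using le dt \<delta> unfolding dt2 Gop_def Xgrad_def Xhess_def abs_less_iff by simp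
    ultimately show ?thesis by blast
  next
    case True
    then have h: "hpart x = hpart y" by simp
    \<comment> \<open>This projection keeps only time, so \<open>\<phi>1\<close> depends on space
      through the gauge alone.\<close>
    define A where "A z = (0 :: real^('m+'k), snd z)" for z :: "(real^('m+'k)) \<times> real"
    define \<phi>1 where "\<phi>1 z = \<phi> (A z + (y, 0)) + N * gauge B y (fst z)" for z
    have linA: "linear A" by (rule linearI) (simp_all add: A_def)
    have j1: "has_jet Omega \<phi>1 (\<lambda>z h. d (A z + (y, 0)) (A h) + N * dgauge B y (fst z) (fst h))
        (\<lambda>z h k. d2 (A z + (y, 0)) (A h) (A k) + N * d2gauge B y (fst z) (fst h) (fst k))"
      unfolding \<phi>1_def by (intro jet_add jet_cmult jet_gauge jet_compose_affine[OF j linA])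
        (auto simp: A_def Omega_def)
    have d0: "d (y, t) (0, 0) = 0" "d2 (y, t) (0, 0) h = 0" for h
      using linear_0[OF has_jet_linear(1)[OF j zO(1)]] linear_0[OF has_jet_linear(2)[OF j zO(1)]]
      by (simp_all add: zero_prod_def)
    have "Xgrad B \<phi>1 (x, t) \<bullet> v = 0" for v
      using Xgrad_inner[OF j1 zO(2), of B v] by (simp add: A_def d0 gauge_derivs_sigma[OF h])
    then have X: "Xgrad B \<phi>1 (x, t) = 0" using inner_eq_zero_iff by blast
    have "v \<bullet> (Xhess B \<phi>1 (x, t) *v w) = 0" for v w
      using Xhess_inner[OF j1 zO(2), of v B w] by (simp add: A_def d0 gauge_derivs_sigma[OF h])
    then have X2: "Xhess B \<phi>1 (x, t) = 0" using matrix_eq_0_iff_inner by blast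
    have dg0: "dgauge B y x 0 = 0" by (simp add: dgauge_def gauge_lin_def)
    have dt1: "dtime \<phi>1 (x, t) = dtime \<phi> (y, t)"
      using jet_derivs(1)[OF j1 open_Omega zO(2)] dty by (simp add: A_def dg0)
    have C2: "C2_on Omega \<phi>1" using j1 C2_on_iff_jet by blast
    have lm: "local_max_at Omega (\<lambda>z. u z - \<phi>1 z) (x, t)"
    proof -
      define r' where "r' = min (\<rho> - dist x0 x) (\<rho> - dist t0 t)"
      have r': "0 < r'" using xyt by (simp add: r'_def)
      have "u (x', t') - \<phi>1 (x', t') \<le> u (x, t) - \<phi>1 (x, t)" if "dist (x', t') (x, t) < r'" for x' t'
      proof -
        have "dist x' x < r'" "dist t' t < r'"
          using that dist_fst_le[of "(x', t')" "(x, t)"] dist_snd_le[of "(x', t')" "(x, t)"] by simp_all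
        then have "dist x0 x' \<le> R" "dist t0 t' \<le> R"
          by (auto simp: r'_def intro: xball tball)
        with mx[of x' y t'] xyt \<rho> show ?thesis by (simp add: \<phi>1_def A_def)
      qed
      then show ?thesis using r' unfolding local_max_at_def by auto
    qed
    have "dtime \<phi>1 (x, t) \<le> 0"
      using test C2 lm t X X2 unfolding sub_test_def by blast
    then have le: "dtime \<phi> (y, t) \<le> 0" by (simp only: dt1)
    \<comment> \<open>The gauge contributes nothing in horizontal directions at \<open>y\<close>
      either, so \<open>ymin\<close> becomes a vanishing horizontal gradient and a nonnegative
      horizontal Hessian of \<open>\<phi>\<close>.\<close>
    have "Xgrad B \<phi> (y, t) \<bullet> v = 0" for v
      using Xgrad_inner[OF j zO(1), of B v] ymin(1)[of "sigma B y *v v"]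
      by (simp add: gauge_derivs_sigma[OF h[symmetric]])
    then have Y: "Xgrad B \<phi> (y, t) = 0" using inner_eq_zero_iff by blast
    have Y2: "psd (Xhess B \<phi> (y, t) - 0)"
      unfolding psd_def using Xhess_inner[OF j zO(1), of _ B] ymin(2)[of "sigma B y *v _"]
      by (simp add: gauge_derivs_sigma[OF h[symmetric]])
    fix i :: 'm
    let ?f = "F y t (axis i 1) 0"
    \<comment> \<open>\<open>\<epsilon>\<close> is the size of an artificial horizontal gradient: at
      most \<open>r/2\<close> to stay near the centre, and small enough that
      \<open>\<epsilon> * ?f\<close>, the value of \<open>F\<close> at
      \<open>axis i \<epsilon>\<close> and the zero matrix, is at most
      \<open>\<delta> / 2\<close>.\<close>
    define \<epsilon> where "\<epsilon> = min (r/2) (\<delta> / (2 * (\<bar>?f\<bar> + 1)))"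
    have \<epsilon>: "\<epsilon> > 0" using r \<delta> by (simp add: \<epsilon>_def add_nonneg_pos)
    have "\<epsilon> * ?f \<le> \<epsilon> * (\<bar>?f\<bar> + 1)" using \<epsilon> by (intro mult_left_mono) auto
    also have "\<dots> \<le> \<delta> / (2 * (\<bar>?f\<bar> + 1)) * (\<bar>?f\<bar> + 1)"
      by (intro mult_right_mono) (auto simp: \<epsilon>_def)
    also have "\<dots> = \<delta> / 2" by (simp add: field_simps add_nonneg_pos)
    finally have small: "\<epsilon> * ?f \<le> \<delta> / 2" .
    let ?q = "grad \<phi> (y, t) + axis (Inl i) \<epsilon>" and ?H = "hess \<phi> (y, t)"
    let ?g = "Gop F B y t ?q ?H"
    have ax: "axis i \<epsilon> \<noteq> 0" using \<epsilon> by (simp add: axis_eq_0_iff)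
    have q: "?q v* sigma B y = axis i \<epsilon>"
      using Y by (simp add: vector_matrix_left_distrib axis_sigma Xgrad_def)
    have sY: "symm ?H" by (rule symm_hess[OF j zO(1)])
    have sX: "symm (Xhess B \<phi> (y, t))" unfolding Xhess_def by (rule symm_sandwich[OF sY])
    have s0: "symm (0 :: real^'m^'m)" by (simp add: symm_def transpose_def vec_eq_iff)
    \<comment> \<open>Discarding the nonnegative Hessian can only raise \<open>F\<close>, by (F2);
      then (F3) with factor \<open>\<epsilon>\<close> and \<open>mu = 0\<close> pulls out the
      scale.\<close>
    have "?g = F y t (axis i \<epsilon>) (Xhess B \<phi> (y, t))" by (simp add: Gop_def q Xhess_def)
    also have "\<dots> \<le> F y t (axis i \<epsilon>) 0"
      using F2[unfolded F2_def, rule_format, of t "axis i \<epsilon>" "Xhess B \<phi> (y, t)" 0 y]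
        t ax s0 Y2 sX by simp
    also have "\<dots> = \<epsilon> * ?f"
    proof -
      have "axis i \<epsilon> = \<epsilon> *\<^sub>R axis i (1::real)" by (simp add: vec_eq_iff axis_def)
      then show ?thesis
        using F3[unfolded F3_def, rule_format, of t "axis i 1" 0 \<epsilon> y 0] t \<epsilon> s0
        by (simp add: axis_eq_0_iff)
    qed
    finally have g: "?g \<le> \<delta> / 2" using small by simp
    \<comment> \<open>Taking both points equal to \<open>y\<close> makes the displacement zero and
      the shift the identity.\<close>
    have "norm (x0 - y, t0 - t, grad \<phi> (x0, t0) - grad \<phi> (y, t), hess \<phi> (x0, t0) - ?H) < r/2"
      using near[of y y t] xyt \<rho>
      by (simp add: disp_self[OF skew] inner_axis inner_axis' matrix_vector_mul_component)
    moreover have "(x0 - y, t0 - t, grad \<phi> (x0, t0) - ?q, hess \<phi> (x0, t0) - ?H) =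
        (x0 - y, t0 - t, grad \<phi> (x0, t0) - grad \<phi> (y, t), hess \<phi> (x0, t0) - ?H) - (0, 0, axis (Inl i) \<epsilon>, 0)"
      by simp
    moreover have "norm (0 :: real^('m+'k), 0 :: real, axis (Inl i :: 'm + 'k) \<epsilon>, 0 :: real^('m+'k)^('m+'k)) \<le> r/2"
    proof -
      have "\<epsilon> \<le> r/2" unfolding \<epsilon>_def by (rule min.cobounded1)
      then show ?thesis using \<epsilon> by (simp add: norm_Pair norm_eq_sqrt_inner inner_axis_axis)
    qed
    ultimately have "norm (x0 - y, t0 - t, grad \<phi> (x0, t0) - ?q, hess \<phi> (x0, t0) - ?H) \<le> r"
      by (smt (verit) norm_triangle_ineq4 field_sum_of_halves)
    then have "?g \<in> G_values F B x0 t0 (grad \<phi> (x0, t0)) (hess \<phi> (x0, t0)) r"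
      using q ax t sY unfolding G_values_def
      by (intro CollectI exI[of _ y] exI[of _ t] exI[of _ ?q] exI[of _ ?H]) simp
    moreover have "dtime \<phi> (x0, t0) + ?g < \<delta>"
      using le dt g unfolding abs_less_iff by linarith
    ultimately show ?thesis by blast
  qed
qed

text \<open>The fourth power of the distance to the centre makes the maximum strict and has
  vanishing first and second derivatives there, so the conclusion is unaffected.\<close>

lemma doubling:
  fixes F :: "('m::finite, 'k::finite) Fop" and B :: "'k \<Rightarrow> real^'m^'m"
  assumes skew: "\<And>k. transpose (B k) = - B k" and F2: "F2 F" and F3: "F3 F"
    and u: "usc_on Omega u" and test: "sub_test F B u"
    and C2: "C2_on Omega \<phi>" and t0: "0 < t0"
    and lm: "local_max_at Omega (\<lambda>z. u z - \<phi> z) (x0, t0)"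
    and r: "0 < r" and \<delta>: "0 < \<delta>"
  shows "\<exists>g\<in>G_values F B x0 t0 (grad \<phi> (x0, t0)) (hess \<phi> (x0, t0)) r. dtime \<phi> (x0, t0) + g < \<delta>"
proof -
  obtain d d2 where j: "has_jet Omega \<phi> d d2" using C2 C2_on_iff_jet by blast
  define \<phi>' where "\<phi>' z = \<phi> z + ((z - (x0, t0)) \<bullet> (z - (x0, t0)))\<^sup>2" for z
  note j' = jet_add[OF j jet_power2[OF jet_inner_self[OF linear_ident, of Omega "(x0, t0)"]],
      folded \<phi>'_def]
  have z: "(x0, t0) \<in> Omega" using t0 by simp
  have eqs: "dtime \<phi>' (x0, t0) = dtime \<phi> (x0, t0)" "grad \<phi>' (x0, t0) = grad \<phi> (x0, t0)"
    "hess \<phi>' (x0, t0) = hess \<phi> (x0, t0)"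
    unfolding jet_derivs[OF j' open_Omega z] jet_derivs[OF j open_Omega z] by simp_all
  obtain R where R: "R > 0" and mx: "\<forall>w\<in>Omega. dist w (x0, t0) < R \<longrightarrow> u w - \<phi> w \<le> u (x0, t0) - \<phi> (x0, t0)"
    using lm unfolding local_max_at_def by blast
  have "u (x, t) - \<phi>' (x, t) < u (x0, t0) - \<phi>' (x0, t0)"
    if "0 < t" "dist (x, t) (x0, t0) < R" "(x, t) \<noteq> (x0, t0)" for x t
  proof -
    have "u (x, t) - \<phi> (x, t) \<le> u (x0, t0) - \<phi> (x0, t0)" using mx that by simp
    moreover have "0 < (((x, t) - (x0, t0)) \<bullet> ((x, t) - (x0, t0)))\<^sup>2"
      using that(3) by (simp del: diff_Pair)
    then have "\<phi> (x, t) < \<phi>' (x, t)" unfolding \<phi>'_def by linarith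
    moreover have "\<phi>' (x0, t0) = \<phi> (x0, t0)" by (simp add: \<phi>'_def)
    ultimately show ?thesis by linarith
  qed
  from doubling_strict[OF skew F2 F3 u test j' t0 R this r \<delta>] show ?thesis
    unfolding eqs .
qed

text \<open>Arbitrarily near the point there are values of \<open>G\<close> almost below
  \<open>c\<close>, while all nearby values tend to one limit \<open>v\<close>; hence
  \<open>v \<le> c\<close>. The limit is \<open>F\<close> itself by continuity, or zero by
  homogeneity.\<close>

lemma G_lower_le_D:
  assumes st: "F_standing F" and F3: "F3 F" and t: "0 < t" and A: "symm A"
    and le: "G_lower F B x t p A \<le> c"
  shows "p v* sigma B x \<noteq> 0 \<Longrightarrow> F x t (p v* sigma B x) (transpose (sigma B x) ** A ** sigma B x) \<le> c"
    and "p v* sigma B x = 0 \<Longrightarrow> transpose (sigma B x) ** A ** sigma B x = 0 \<Longrightarrow> 0 \<le> c"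
proof -
  let ?p = "p v* sigma B x" and ?A = "transpose (sigma B x) ** A ** sigma B x"
  have key: "v \<le> c" if near: "\<And>\<delta>. \<delta> > 0 \<Longrightarrow> \<exists>\<rho>>0. \<forall>y s q C. 0 < s \<longrightarrow> q \<noteq> 0 \<longrightarrow> symm C \<longrightarrow>
      norm ((y, s, q, C) - (x, t, ?p, ?A)) < \<rho> \<longrightarrow> \<bar>F y s q C - v\<bar> < \<delta>" for v
  proof (rule field_le_epsilon)
    fix e :: real assume e: "0 < e"
    obtain \<rho> where "\<rho> > 0" and "\<forall>y s q C. 0 < s \<longrightarrow> q \<noteq> 0 \<longrightarrow> symm C \<longrightarrow>
      norm ((y, s, q, C) - (x, t, ?p, ?A)) < \<rho> \<longrightarrow> \<bar>F y s q C - v\<bar> < e/2"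
      using near[OF half_gt_zero[OF e]] by blast
    then obtain r where r: "r > 0" "\<forall>g\<in>G_values F B x t p A r. \<bar>g - v\<bar> < e/2"
      using G_values_near[of \<rho> x t p B A "\<lambda>g. \<bar>g - v\<bar> < e/2" F] by blast
    obtain g where g: "g \<in> G_values F B x t p A r" "g < c + e/2"
      using le[unfolded G_lower_limit(2)[OF st t A]] r(1) half_gt_zero[OF e] by blast
    have "\<bar>g - v\<bar> < e/2" using r(2) g(1) by blast
    then show "v \<le> c + e" using g(2) unfolding abs_less_iff by simp
  qed
  show "F x t ?p ?A \<le> c" if "?p \<noteq> 0"
    by (rule key) (rule F_near[OF st t that symm_sandwich[OF A]])
  show "0 \<le> c" if "?p = 0" "?A = 0"
  proof (rule key)
    fix \<delta> :: real assume "\<delta> > 0"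
    from F_near_zero[OF st F3 t this, of x]
    show "\<exists>\<rho>>0. \<forall>y s q C. 0 < s \<longrightarrow> q \<noteq> 0 \<longrightarrow> symm C \<longrightarrow>
      norm ((y, s, q, C) - (x, t, ?p, ?A)) < \<rho> \<longrightarrow> \<bar>F y s q C - 0\<bar> < \<delta>"
      unfolding that by simp
  qed
qed

lemma visc_sub_iff_sub_test:
  fixes F :: "('m::finite, 'k::finite) Fop" and B :: "'k \<Rightarrow> real^'m^'m"
  assumes skew: "\<And>k. transpose (B k) = - B k"
    and st: "F_standing F" and F2: "F2 F" and F3: "F3 F" and u: "usc_on Omega u"
  shows "visc_sub F B u \<longleftrightarrow> sub_test F B u"
proof
  assume v: "visc_sub F B u"
  show "sub_test F B u"
    unfolding sub_test_def
  proof (intro allI impI)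
    fix \<phi> x t assume C2: "C2_on Omega \<phi>" and *: "0 < t \<and> local_max_at Omega (\<lambda>z. u z - \<phi> z) (x, t)"
    obtain d d2 where j: "has_jet Omega \<phi> d d2" using C2 C2_on_iff_jet by blast
    have t: "0 < t" and z: "(x, t) \<in> Omega" using * by simp_all
    have "dtime \<phi> (x, t) + G_lower F B x t (grad \<phi> (x, t)) (hess \<phi> (x, t)) \<le> 0"
      using v C2 * unfolding visc_sub_def by blast
    then have "G_lower F B x t (grad \<phi> (x, t)) (hess \<phi> (x, t)) \<le> - dtime \<phi> (x, t)" by simp
    note D = G_lower_le_D[OF st F3 t symm_hess[OF j z] this]
    show "(Xgrad B \<phi> (x, t) \<noteq> 0 \<longrightarrow>
           dtime \<phi> (x, t) + F x t (Xgrad B \<phi> (x, t)) (Xhess B \<phi> (x, t)) \<le> 0)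
      \<and> (Xgrad B \<phi> (x, t) = 0 \<and> Xhess B \<phi> (x, t) = 0 \<longrightarrow> dtime \<phi> (x, t) \<le> 0)"
      using D unfolding Xgrad_def Xhess_def by force
  qed
next
  assume test: "sub_test F B u"
  show "visc_sub F B u"
    unfolding visc_sub_def
  proof (intro conjI allI impI u)
    fix \<phi> x t assume C2: "C2_on Omega \<phi>" and *: "0 < t \<and> local_max_at Omega (\<lambda>z. u z - \<phi> z) (x, t)"
    obtain d d2 where j: "has_jet Omega \<phi> d d2" using C2 C2_on_iff_jet by blast
    have t: "0 < t" and z: "(x, t) \<in> Omega" using * by simp_all
    have "G_lower F B x t (grad \<phi> (x, t)) (hess \<phi> (x, t)) \<le> - dtime \<phi> (x, t)"
      unfolding G_lower_limit(2)[OF st t symm_hess[OF j z]]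
    proof (intro allI impI)
      fix r \<delta> :: real assume "0 < r" "0 < \<delta>"
      from doubling[OF skew F2 F3 u test C2 t conjunct2[OF *] this]
      obtain g where "g \<in> G_values F B x t (grad \<phi> (x, t)) (hess \<phi> (x, t)) r"
        "dtime \<phi> (x, t) + g < \<delta>" by blast
      then show "\<exists>g\<in>G_values F B x t (grad \<phi> (x, t)) (hess \<phi> (x, t)) r. g < - dtime \<phi> (x, t) + \<delta>"
        by (intro bexI[of _ g]) auto
    qed
    then show "dtime \<phi> (x, t) + G_lower F B x t (grad \<phi> (x, t)) (hess \<phi> (x, t)) \<le> 0" by simp
  qed
qed

section \<open>Reduction of supersolutions to subsolutions\<close>

lemma C2_on_uminus:
  assumes "C2_on S \<phi>" shows "C2_on S (\<lambda>z. - \<phi> z)"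
proof -
  obtain d d2 where "has_jet S \<phi> d d2" using assms C2_on_iff_jet by blast
  from jet_cmult[OF this, of "- 1"] show ?thesis unfolding C2_on_iff_jet by auto
qed

lemma C2_on_uminus_iff: "C2_on S (\<lambda>z. - \<phi> z) \<longleftrightarrow> C2_on S \<phi>"
  using C2_on_uminus[of S \<phi>] C2_on_uminus[of S "\<lambda>z. - \<phi> z"] by auto

lemma uminus_derivs:
  fixes B :: "'k::finite \<Rightarrow> real^'m::finite^'m"
  assumes C2: "C2_on Omega \<phi>" and z: "z \<in> Omega"
  shows "dtime (\<lambda>z. - \<phi> z) z = - dtime \<phi> z"
    and "grad (\<lambda>z. - \<phi> z) z = - grad \<phi> z"
    and "hess (\<lambda>z. - \<phi> z) z = - hess \<phi> z"
    and "Xgrad B (\<lambda>z. - \<phi> z) z = - Xgrad B \<phi> z"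
    and "Xhess B (\<lambda>z. - \<phi> z) z = - Xhess B \<phi> z"
proof -
  obtain d d2 where j: "has_jet Omega \<phi> d d2" using C2 C2_on_iff_jet by blast
  from jet_cmult[OF j, of "- 1"]
  have j': "has_jet Omega (\<lambda>z. - \<phi> z) (\<lambda>z h. - d z h) (\<lambda>z h k. - d2 z h k)" by simp
  show "dtime (\<lambda>z. - \<phi> z) z = - dtime \<phi> z"
    and g: "grad (\<lambda>z. - \<phi> z) z = - grad \<phi> z"
    and h: "hess (\<lambda>z. - \<phi> z) z = - hess \<phi> z"
    unfolding jet_derivs[OF j' open_Omega z] jet_derivs[OF j open_Omega z]
    by (simp_all add: vec_eq_iff)
  show "Xgrad B (\<lambda>z. - \<phi> z) z = - Xgrad B \<phi> z"
    by (simp add: Xgrad_def g vector_matrix_mult_def vec_eq_iff sum_negf)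
  show "Xhess B (\<lambda>z. - \<phi> z) z = - Xhess B \<phi> z"
    by (simp add: Xhess_def h matrix_matrix_mult_def vec_eq_iff sum_negf)
qed

text \<open>Negation permutes the real functions; the form with arbitrary \<open>P\<close> replaces
  every test function by its negative in one step.\<close>

lemma all_uminus_iff: "(\<forall>f :: 'a \<Rightarrow> real. P f) \<longleftrightarrow> (\<forall>f. P (\<lambda>z. - f z))"
proof (intro iffI allI)
  fix f assume "\<forall>f. P (\<lambda>z. - f z)"
  from spec[OF this, of "\<lambda>z. - f z"] show "P f" by simp
qed simp

lemma local_max_uminus_iff: "local_max_at S (\<lambda>z. - u z - - \<phi> z) z \<longleftrightarrow> local_min_at S (\<lambda>z. u z - \<phi> z) z"
  unfolding local_max_at_def local_min_at_def by (simp add: algebra_simps)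

text \<open>Test functions for \<open>u\<close> at minima are the negatives of those for
  \<open>- u\<close> at maxima, and \<open>G_upper_dual\<close> turns the upper envelope into the
  negated lower one.\<close>

lemma visc_super_iff_visc_sub_dual:
  assumes st: "F_standing F"
  shows "visc_super F B u \<longleftrightarrow> visc_sub (dual_op F) B (\<lambda>z. - u z)"
proof -
  have key: "dtime \<phi> (x, t) + G_upper F B x t (grad \<phi> (x, t)) (hess \<phi> (x, t)) \<ge> 0 \<longleftrightarrow>
      dtime (\<lambda>z. - \<phi> z) (x, t) + G_lower (dual_op F) B x t (grad (\<lambda>z. - \<phi> z) (x, t))
        (hess (\<lambda>z. - \<phi> z) (x, t)) \<le> 0" if C2: "C2_on Omega \<phi>" and t: "0 < t" for \<phi> x t
  proof -
    obtain d d2 where j: "has_jet Omega \<phi> d d2" using C2 C2_on_iff_jet by blast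
    have z: "(x, t) \<in> Omega" using t by simp
    show ?thesis
      unfolding uminus_derivs[OF C2 z] G_upper_dual[OF st t symm_hess[OF j z]] by auto
  qed
  have "visc_sub (dual_op F) B (\<lambda>z. - u z) \<longleftrightarrow> usc_on Omega (\<lambda>z. - u z) \<and>
     (\<forall>\<phi>. C2_on Omega (\<lambda>z. - \<phi> z) \<longrightarrow>
       (\<forall>x t. 0 < t \<and> local_max_at Omega (\<lambda>z. - u z - - \<phi> z) (x, t) \<longrightarrow>
        dtime (\<lambda>z. - \<phi> z) (x, t) + G_lower (dual_op F) B x t (grad (\<lambda>z. - \<phi> z) (x, t))
          (hess (\<lambda>z. - \<phi> z) (x, t)) \<le> 0))"
    unfolding visc_sub_def by (intro conj_cong refl all_uminus_iff)
  also have "\<dots> \<longleftrightarrow> visc_super F B u"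
    unfolding visc_super_def usc_on_minus_iff C2_on_uminus_iff local_max_uminus_iff
    by (intro conj_cong refl all_cong1 imp_cong) (use key in blast)
  finally show ?thesis by (rule sym)
qed

theorem theorem3p2:
  fixes F :: "('m::finite, 'k::finite) Fop" and B :: "'k \<Rightarrow> real^'m^'m"
  assumes "2 \<le> CARD('m)"
    and "step2_data B"
    and "F_standing F" and "F1 F" and "F2 F" and "F3 F"
  shows "(\<forall>u. usc_on Omega u \<longrightarrow>
            (visc_sub F B u \<longleftrightarrow>
              (\<forall>\<phi>. C2_on Omega \<phi> \<longrightarrow> (\<forall>x t. 0 < t \<and> local_max_at Omega (\<lambda>z. u z - \<phi> z) (x, t) \<longrightarrow>
                 (Xgrad B \<phi> (x, t) \<noteq> 0 \<longrightarrow>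
                    dtime \<phi> (x, t) + F x t (Xgrad B \<phi> (x, t)) (Xhess B \<phi> (x, t)) \<le> 0)
               \<and> (Xgrad B \<phi> (x, t) = 0 \<and> Xhess B \<phi> (x, t) = 0 \<longrightarrow> dtime \<phi> (x, t) \<le> 0)))))
       \<and> (\<forall>u. lsc_on Omega u \<longrightarrow>
            (visc_super F B u \<longleftrightarrow>
              (\<forall>\<phi>. C2_on Omega \<phi> \<longrightarrow> (\<forall>x t. 0 < t \<and> local_min_at Omega (\<lambda>z. u z - \<phi> z) (x, t) \<longrightarrow>
                 (Xgrad B \<phi> (x, t) \<noteq> 0 \<longrightarrow>
                    dtime \<phi> (x, t) + F x t (Xgrad B \<phi> (x, t)) (Xhess B \<phi> (x, t)) \<ge> 0)
               \<and> (Xgrad B \<phi> (x, t) = 0 \<and> Xhess B \<phi> (x, t) = 0 \<longrightarrow> dtime \<phi> (x, t) \<ge> 0)))))"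
proof (intro conjI allI impI)
  have skew: "\<And>k. transpose (B k) = - B k" using assms(2) by (simp add: step2_data_def)
  fix u :: "(real^('m+'k)) \<times> real \<Rightarrow> real"
  {
    assume "usc_on Omega u"
    from visc_sub_iff_sub_test[where B = B, OF skew assms(3,5,6) this]
    show "visc_sub F B u \<longleftrightarrow>
      (\<forall>\<phi>. C2_on Omega \<phi> \<longrightarrow> (\<forall>x t. 0 < t \<and> local_max_at Omega (\<lambda>z. u z - \<phi> z) (x, t) \<longrightarrow>
         (Xgrad B \<phi> (x, t) \<noteq> 0 \<longrightarrow>
            dtime \<phi> (x, t) + F x t (Xgrad B \<phi> (x, t)) (Xhess B \<phi> (x, t)) \<le> 0)
       \<and> (Xgrad B \<phi> (x, t) = 0 \<and> Xhess B \<phi> (x, t) = 0 \<longrightarrow> dtime \<phi> (x, t) \<le> 0)))"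
      unfolding sub_test_def .
  next
    assume "lsc_on Omega u"
    then have "usc_on Omega (\<lambda>z. - u z)" by (rule usc_on_minus)
    note sub = visc_sub_iff_sub_test[where B = B, OF skew F_standing_dual[OF assms(3)] F2_dual[OF assms(5)]
        F3_dual[OF assms(6)] this]
    let ?P = "\<lambda>F \<phi> x t. (Xgrad B \<phi> (x, t) \<noteq> 0 \<longrightarrow>
         dtime \<phi> (x, t) + F x t (Xgrad B \<phi> (x, t)) (Xhess B \<phi> (x, t)) \<le> 0)
       \<and> (Xgrad B \<phi> (x, t) = 0 \<and> Xhess B \<phi> (x, t) = 0 \<longrightarrow> dtime \<phi> (x, t) \<le> 0)"
    let ?Q = "\<lambda>\<phi> x t. (Xgrad B \<phi> (x, t) \<noteq> 0 \<longrightarrow>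
         dtime \<phi> (x, t) + F x t (Xgrad B \<phi> (x, t)) (Xhess B \<phi> (x, t)) \<ge> 0)
       \<and> (Xgrad B \<phi> (x, t) = 0 \<and> Xhess B \<phi> (x, t) = 0 \<longrightarrow> dtime \<phi> (x, t) \<ge> 0)"
    \<comment> \<open>Negating \<open>\<phi>\<close> flips the sign of all its derivatives;
      \<open>dual_op\<close> undoes this inside \<open>F\<close> and adds an outer minus, so both
      inequalities reverse.\<close>
    have PQ: "?P (dual_op F) (\<lambda>z. - \<phi> z) x t \<longleftrightarrow> ?Q \<phi> x t" if "C2_on Omega \<phi>" "0 < t" for \<phi> x t
    proof -
      have "(x, t) \<in> Omega" using that by simp
      note uminus_derivs[OF that(1) this]
      then show ?thesis by (auto simp: dual_op_def)
    qed
    have "visc_super F B u \<longleftrightarrow> sub_test (dual_op F) B (\<lambda>z. - u z)"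
      using visc_super_iff_visc_sub_dual[OF assms(3)] sub by blast
    also have "\<dots> \<longleftrightarrow> (\<forall>\<phi>. C2_on Omega (\<lambda>z. - \<phi> z) \<longrightarrow>
        (\<forall>x t. 0 < t \<and> local_max_at Omega (\<lambda>z. - u z - - \<phi> z) (x, t) \<longrightarrow> ?P (dual_op F) (\<lambda>z. - \<phi> z) x t))"
      unfolding sub_test_def by (rule all_uminus_iff)
    also have "\<dots> \<longleftrightarrow> (\<forall>\<phi>. C2_on Omega \<phi> \<longrightarrow>
        (\<forall>x t. 0 < t \<and> local_min_at Omega (\<lambda>z. u z - \<phi> z) (x, t) \<longrightarrow> ?Q \<phi> x t))"
      unfolding C2_on_uminus_iff local_max_uminus_iff by (intro all_cong1 imp_cong refl) (use PQ in blast)+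
    finally show "visc_super F B u \<longleftrightarrow> (\<forall>\<phi>. C2_on Omega \<phi> \<longrightarrow>
        (\<forall>x t. 0 < t \<and> local_min_at Omega (\<lambda>z. u z - \<phi> z) (x, t) \<longrightarrow> ?Q \<phi> x t))" .
  }
qed

end
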